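(* Let $d\ge 2$ be an integer, $p\in(1,\infty)$ and $s\in\mathbb{R}$. (1) If there is a constant $C$ such that $$\|U(t)u_0\|_{L^p_xL^\infty_{y,t\in[0,1]}}\le C\|u_0\|_{H^s(\mathbb{R}^d)}\qquad\text{for all }u_0\in\mathcal{S}(\mathbb{R}^d),$$ then $p\in[2,+\infty)$ and $s\ge \frac d2-\frac1p$. (2) If there is a constant $C$ such that $$\|U(t)u_0\|_{L^p_{x,y}L^\infty_{t\in[0,1]}}\le C\|u_0\|_{H^s(\mathbb{R}^d)}\qquad\text{for all }u_0\in\mathcal{S}(\mathbb{R}^d),$$ then $p\in[2,+\infty)$ and $$s\ge\max\left\{d\left(\frac12-\frac1p\right),\ \frac{3}{2p}-\frac d2\left(\frac12-\frac1p\right)\right\}.$$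
   Context: Points of $\mathbb{R}^d$ are written $(x,y)$ with $x\in\mathbb{R}$, $y\in\mathbb{R}^{d-1}$, and frequencies $(\xi,\eta)$ with $\xi\in\mathbb{R}$, $\eta\in\mathbb{R}^{d-1}$. $\{U(t)\}_{t\in\mathbb{R}}$ is the unitary group of the linear equation $\partial_tu+\partial_x\Delta u=0$ on $\mathbb{R}^d\times\mathbb{R}$, given by $\widehat{U(t)u_0}(\xi,\eta)=e^{it\xi(\xi^2+|\eta|^2)}\widehat{u_0}(\xi,\eta)$, the Fourier transform being in the space variables. $H^s(\mathbb{R}^d)$ is the inhomogeneous $L^2$-based Sobolev space. Mixed norms: $\|F\|_{L^p_xL^\infty_{y,t\in[0,1]}}=\big(\int_{\mathbb{R}}\sup_{y\in\mathbb{R}^{d-1},\,t\in[0,1]}|F(x,y,t)|^p\,dx\big)^{1/p}$ and $\|F\|_{L^p_{x,y}L^\infty_{t\in[0,1]}}=\big(\int_{\mathbb{R}^d}\sup_{t\in[0,1]}|F(x,y,t)|^p\,dx\,dy\big)^{1/p}$. *)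

theory Defs
  imports "HOL-Analysis.Analysis"
begin

primrec iterated_partial ::
    "'a::euclidean_space list \<Rightarrow> ('a \<Rightarrow> complex) \<Rightarrow> 'a \<Rightarrow> complex" where
  "iterated_partial [] f = f"
| "iterated_partial (v # vs) f = (\<lambda>z. frechet_derivative (iterated_partial vs f) (at z) v)"

(* The differentiability clause matters: frechet_derivative is unspecified at points where the
   function is not differentiable. *)
definition schwartz :: "('a::euclidean_space \<Rightarrow> complex) \<Rightarrow> bool" where
  "schwartz f \<longleftrightarrow>
     (\<forall>vs. set vs \<subseteq> Basis \<longrightarrow>
        (\<forall>z. iterated_partial vs f differentiable (at z)) \<and>
        (\<forall>k::nat. \<exists>B. \<forall>z. norm z ^ k * norm (iterated_partial vs f z) \<le> B))"

(* Unitary normalisation with angular frequencies. With this phase, the partial derivative in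
   coordinate j becomes multiplication by i times the j-th frequency, so that u_t + (Laplacian u)_x = 0
   has the multiplier exp(i t \<xi> (\<xi>^2 + |\<eta>|^2)). *)
definition fourier :: "('a::euclidean_space \<Rightarrow> complex) \<Rightarrow> 'a \<Rightarrow> complex" where
  "fourier f \<zeta> = complex_of_real ((2 * pi) powr (- real DIM('a) / 2)) *
     (LINT z|lborel. exp (- \<i> * complex_of_real (z \<bullet> \<zeta>)) * f z)"

definition inverse_fourier :: "('a::euclidean_space \<Rightarrow> complex) \<Rightarrow> 'a \<Rightarrow> complex" where
  "inverse_fourier g z = complex_of_real ((2 * pi) powr (- real DIM('a) / 2)) *
     (LINT \<zeta>|lborel. exp (\<i> * complex_of_real (z \<bullet> \<zeta>)) * g \<zeta>)"

definition linear_group ::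
    "real \<Rightarrow> (real \<times> (real ^ 'n::finite) \<Rightarrow> complex) \<Rightarrow> real \<times> (real ^ 'n) \<Rightarrow> complex" where
  "linear_group t u\<^sub>0 = inverse_fourier (\<lambda>(\<xi>, \<eta>).
     exp (\<i> * complex_of_real (t * (\<xi> * (\<xi>\<^sup>2 + (norm \<eta>)\<^sup>2)))) * fourier u\<^sub>0 (\<xi>, \<eta>))"

(* Intended for exponents r > 0 only: the value at \<infinity> is \<infinity>. *)
definition ennreal_rpow :: "ennreal \<Rightarrow> real \<Rightarrow> ennreal" where
  "ennreal_rpow a r = (if a = \<infinity> then \<infinity> else ennreal (enn2real a powr r))"

definition sobolev_norm :: "real \<Rightarrow> ('a::euclidean_space \<Rightarrow> complex) \<Rightarrow> ennreal" where
  "sobolev_norm s f = ennreal_rpow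
     (\<integral>\<^sup>+ \<zeta>. ennreal ((1 + (norm \<zeta>)\<^sup>2) powr s * (norm (fourier f \<zeta>))\<^sup>2) \<partial>lborel) (1 / 2)"

(* In both mixed norms the argument F takes the time first, F t (x, y). *)
definition norm_Lp_x_Linf_yt ::
    "real \<Rightarrow> (real \<Rightarrow> real \<times> (real ^ 'n::finite) \<Rightarrow> complex) \<Rightarrow> ennreal" where
  "norm_Lp_x_Linf_yt p F = ennreal_rpow
     (\<integral>\<^sup>+ x. (SUP (y, t) \<in> UNIV \<times> {0..1}. ennreal (norm (F t (x, y)) powr p)) \<partial>lborel) (1 / p)"

definition norm_Lp_xy_Linf_t ::
    "real \<Rightarrow> (real \<Rightarrow> real \<times> (real ^ 'n::finite) \<Rightarrow> complex) \<Rightarrow> ennreal" where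
  "norm_Lp_xy_Linf_t p F = ennreal_rpow
     (\<integral>\<^sup>+ z. (SUP t \<in> {0..1}. ennreal (norm (F t z) powr p)) \<partial>lborel) (1 / p)"

end

theory Submission
  imports Defs "HOL-Probability.Characteristic_Functions"
begin

text \<open>
  All conditions are obtained by testing the estimate on Gaussian wave packets with
  Fourier transform \<open>exp (- (\<alpha>\<^sup>2 (\<xi> - N)\<^sup>2 + \<beta>\<^sup>2 \<bar>\<eta>\<bar>\<^sup>2) / 2)\<close>.  After rescaling frequencies around
  \<open>(N, 0)\<close>, the modulus of the solution at \<open>(x, y, t)\<close> is an oscillatory Gaussian integral, which is
  bounded below as long as its phase is small.  At time \<open>t = 0\<close> with \<open>N = 0\<close> this holds for
  \<open>\<bar>x\<bar> \<le> c \<alpha>\<close>, \<open>\<bar>y\<bar> \<le> c \<beta>\<close>: the packets with \<open>\<alpha> \<rightarrow> \<infinity>\<close>, \<open>\<beta> = 1\<close> force \<open>p \<ge> 2\<close>, and those with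
  \<open>\<alpha> = \<beta> \<rightarrow> 0\<close> force the Sobolev-type conditions \<open>s \<ge> d/2 - 1/p\<close> and \<open>s \<ge> d (1/2 - 1/p)\<close>.
  The remaining condition comes from \<open>\<alpha> = \<beta> = \<surd>N\<close>, \<open>N \<rightarrow> \<infinity>\<close>: such a packet travels with velocity
  \<open>-3 N\<^sup>2\<close> in the \<open>x\<close> direction without dispersing for times \<open>t \<le> c\<close>, so the maximal function
  is large on a tube of length \<open>N\<^sup>2\<close> and width \<open>\<surd>N\<close>.
\<close>

section \<open>Gaussian integrals\<close>

text \<open>Lebesgue measure is the image of the product measure over \<open>Basis\<close> under the
  map \<open>T\<close> from coordinate families to vectors, so Fubini for finite products applies to
  integrands that split into one-variable factors.\<close>

lemma
  fixes f :: "'a::euclidean_space \<Rightarrow> real \<Rightarrow> complex"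
  assumes f: "\<And>b. b \<in> Basis \<Longrightarrow> integrable lborel (f b)"
  shows integrable_lborel_prod: "integrable lborel (\<lambda>x. \<Prod>b\<in>Basis. f b (x \<bullet> b))"
    and integral_lborel_prod:
      "(LINT x|lborel. (\<Prod>b\<in>Basis. f b (x \<bullet> b))) = (\<Prod>b\<in>Basis. (LINT x|lborel. f b x))"
proof -
  interpret product_sigma_finite "\<lambda>_::'a. lborel :: real measure"
    by standard
  define T :: "('a \<Rightarrow> real) \<Rightarrow> 'a" where "T = (\<lambda>g. \<Sum>b\<in>Basis. g b *\<^sub>R b)"
  have T [measurable]: "T \<in> (\<Pi>\<^sub>M b\<in>Basis. lborel) \<rightarrow>\<^sub>M borel"
    unfolding T_def by measurable
  have [measurable]: "b \<in> Basis \<Longrightarrow> f b \<in> borel_measurable borel" for b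
    using f[of b] by (simp add: borel_measurable_integrable)
  have Tb: "T g \<bullet> b = g b" if "b \<in> Basis" for g b
    using that by (simp add: T_def inner_sum_left inner_Basis if_distrib cong: if_cong)
  have eq: "(\<Prod>b\<in>Basis. f b (T g \<bullet> b)) = (\<Prod>b\<in>Basis. f b (g b))" for g
    by (intro prod.cong) (auto simp: Tb)
  have meas: "(\<lambda>x. \<Prod>b\<in>Basis. f b (x \<bullet> b)) \<in> borel_measurable borel"
    by measurable
  show "integrable lborel (\<lambda>x. \<Prod>b\<in>Basis. f b (x \<bullet> b))"
    unfolding lborel_eq[where 'a='a] T_def[symmetric]
    by (subst integrable_distr_eq[OF T meas]) (simp add: eq f product_integrable_prod)
  show "(LINT x|lborel. (\<Prod>b\<in>Basis. f b (x \<bullet> b))) = (\<Prod>b\<in>Basis. (LINT x|lborel. f b x))"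
    by (subst lborel_eq[where 'a='a], unfold T_def[symmetric], subst integral_distr[OF T meas])
       (simp add: eq f product_integral_prod)
qed

text \<open>A diagonal substitution with a separate scale for each coordinate, as packets have
  different widths in x and y. The Jacobian is the product of the scales. The argument transports
  the measure itself, so measurability of the integrand suffices.\<close>

lemma
  fixes f :: "'a::euclidean_space \<Rightarrow> 'b::{banach, second_countable_topology}" and w :: "'a \<Rightarrow> real"
  assumes w: "\<And>b. b \<in> Basis \<Longrightarrow> 0 < w b"
  shows integral_lborel_affine_Basis:
      "f \<in> borel_measurable borel \<Longrightarrow> (LINT x|lborel. f x) = (\<Prod>b\<in>Basis. w b) *\<^sub>R
         (LINT x|lborel. f (t + (\<Sum>b\<in>Basis. (w b * (x \<bullet> b)) *\<^sub>R b)))"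
    and nn_integral_lborel_affine_Basis:
      "g \<in> borel_measurable borel \<Longrightarrow> (\<integral>\<^sup>+x. g x \<partial>lborel) = ennreal (\<Prod>b\<in>Basis. w b) *
         (\<integral>\<^sup>+x. g (t + (\<Sum>b\<in>Basis. (w b * (x \<bullet> b)) *\<^sub>R b)) \<partial>lborel)"
proof -
  have [measurable]: "(\<lambda>x. t + (\<Sum>b\<in>Basis. (w b * (x \<bullet> b)) *\<^sub>R b)) \<in> borel \<rightarrow>\<^sub>M borel"
    by measurable
  have eq: "(lborel :: 'a measure) = density (distr lborel borel
      (\<lambda>x. t + (\<Sum>b\<in>Basis. (w b * (x \<bullet> b)) *\<^sub>R b))) (\<lambda>_. ennreal (\<Prod>b\<in>Basis. w b))"
    by (subst lborel_affine_euclidean[of w t])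
       (use w in \<open>auto simp: less_imp_neq[symmetric] less_imp_le intro!: arg_cong2[where f=density] prod.cong\<close>)
  have pos: "0 \<le> (\<Prod>b\<in>Basis. w b)"
    by (intro prod_nonneg) (auto simp: w less_imp_le)
  show "(LINT x|lborel. f x) = (\<Prod>b\<in>Basis. w b) *\<^sub>R
         (LINT x|lborel. f (t + (\<Sum>b\<in>Basis. (w b * (x \<bullet> b)) *\<^sub>R b)))"
    if [measurable]: "f \<in> borel_measurable borel"
    by (subst eq) (simp add: integral_density integral_distr pos)
  show "(\<integral>\<^sup>+x. g x \<partial>lborel) = ennreal (\<Prod>b\<in>Basis. w b) *
         (\<integral>\<^sup>+x. g (t + (\<Sum>b\<in>Basis. (w b * (x \<bullet> b)) *\<^sub>R b)) \<partial>lborel)"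
    if [measurable]: "g \<in> borel_measurable borel"
    by (subst eq) (simp add: nn_integral_density nn_integral_distr nn_integral_cmult)
qed

text \<open>Up to the factor sqrt(2 pi), the integral is the characteristic function of the standard
  normal distribution, which is its own Fourier transform.\<close>

lemma
  shows integrable_gaussian_cis: "integrable lborel (\<lambda>x. exp (\<i> * complex_of_real (t * x)) *
      complex_of_real (exp (- x\<^sup>2 / 2)))"
    and integral_gaussian_cis: "(LINT x|lborel. exp (\<i> * complex_of_real (t * x)) *
      complex_of_real (exp (- x\<^sup>2 / 2))) = complex_of_real (sqrt (2 * pi) * exp (- t\<^sup>2 / 2))"
proof -
  have d: "exp (- x\<^sup>2 / 2) = sqrt (2 * pi) * std_normal_density x" for x :: real
    by (simp add: std_normal_density_def)
  have i: "integrable lborel (\<lambda>x. complex_of_real (std_normal_density x))"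
    by (intro integrable_of_real integrable_normal_density) simp
  show "integrable lborel (\<lambda>x. exp (\<i> * complex_of_real (t * x)) *
      complex_of_real (exp (- x\<^sup>2 / 2)))"
    by (rule Bochner_Integration.integrable_bound[OF integrable_mult_right[OF i, of "complex_of_real (sqrt (2 * pi))"]])
       (auto simp: std_normal_density_def norm_mult)
  have "complex_of_real (exp (- t\<^sup>2 / 2)) = char std_normal_distribution t"
    by (simp add: char_std_normal_distribution)
  also have "\<dots> = (LINT x|lborel. std_normal_density x *\<^sub>R iexp (t * x))"
    by (simp add: char_def integral_density normal_density_nonneg)
  also have "\<dots> = (LINT x|lborel. exp (\<i> * complex_of_real (t * x)) *
      complex_of_real (exp (- x\<^sup>2 / 2)) / complex_of_real (sqrt (2 * pi)))"
    by (intro Bochner_Integration.integral_cong) (auto simp: std_normal_density_def scaleR_conv_of_real)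
  finally show "(LINT x|lborel. exp (\<i> * complex_of_real (t * x)) *
      complex_of_real (exp (- x\<^sup>2 / 2))) = complex_of_real (sqrt (2 * pi) * exp (- t\<^sup>2 / 2))"
    by (simp add: field_simps)
qed

lemma integrable_exp_neg_norm_square:
  fixes c :: real
  assumes "0 < c"
  shows "integrable lborel (\<lambda>x::'a::euclidean_space. exp (- c * (norm x)\<^sup>2))"
proof -
  have "integrable lborel (\<lambda>x::real. exp (- x\<^sup>2 / 2))"
    using integrable_norm[OF integrable_gaussian_cis[of 0]] by simp
  \<comment> \<open>The substitution x -> sqrt(2c) x turns the exponent x^2/2 into c x^2.\<close>
  from lborel_integrable_real_affine[OF this, of "sqrt (2 * c)" 0]
  have "integrable lborel (\<lambda>x::real. exp (- c * x\<^sup>2))"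
    using assms by (simp add: power_mult_distrib)
  then have "integrable lborel (\<lambda>x::'a. \<Prod>b\<in>Basis. complex_of_real (exp (- c * (x \<bullet> b)\<^sup>2)))"
    by (intro integrable_lborel_prod integrable_of_real)
  also have "(\<lambda>x::'a. \<Prod>b\<in>Basis. complex_of_real (exp (- c * (x \<bullet> b)\<^sup>2))) =
      (\<lambda>x. complex_of_real (exp (- c * (norm x)\<^sup>2)))"
    unfolding of_real_prod[symmetric] exp_sum[OF finite_Basis, symmetric]
    by (subst euclidean_inner[of x x for x, folded power2_norm_eq_inner power2_eq_square])
      (simp add: sum_distrib_left sum_negf)
  finally show ?thesis
    using complex_of_real_integrable_eq by blast
qed

section \<open>Gaussian packets are Schwartz functions\<close>

text \<open>The vector \<open>w\<close> collects the widths in the coordinate directions and \<nu>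
  is the central frequency. Dividing by the widths gives the Fourier transform peak value 1 at
  \<nu>, and the product form permits integration one coordinate at a time.\<close>

definition gaussian_packet :: "'a::euclidean_space \<Rightarrow> 'a \<Rightarrow> 'a \<Rightarrow> complex" where
  "gaussian_packet w \<nu> z =
     (\<Prod>b\<in>Basis. exp (\<i> * complex_of_real ((\<nu> \<bullet> b) * (z \<bullet> b)) -
        complex_of_real (((z \<bullet> b) / (w \<bullet> b))\<^sup>2 / 2)) / complex_of_real (w \<bullet> b))"

lemma fourier_gaussian_packet:
  fixes w \<nu> \<zeta> :: "'a::euclidean_space"
  assumes w: "\<And>b. b \<in> Basis \<Longrightarrow> 0 < w \<bullet> b"
  shows "fourier (gaussian_packet w \<nu>) \<zeta> =
    complex_of_real (exp (- (\<Sum>b\<in>Basis. ((w \<bullet> b) * ((\<zeta> - \<nu>) \<bullet> b))\<^sup>2) / 2))"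
proof -
  \<comment> \<open>\<open>f b\<close> is the factor of the Fourier integrand in direction
    \<open>b\<close>. In the variable x divided by the width it becomes \<open>h b\<close>, a
    standard Gaussian with a frequency shifted by \<nu> and scaled by the width.\<close>
  define f where "f b x = exp (- \<i> * complex_of_real (x * (\<zeta> \<bullet> b))) * 
     (exp (\<i> * complex_of_real ((\<nu> \<bullet> b) * x) - complex_of_real ((x / (w \<bullet> b))\<^sup>2 / 2)) /
        complex_of_real (w \<bullet> b))" for b x
  define h where "h b x = exp (\<i> * complex_of_real (((w \<bullet> b) * ((\<nu> - \<zeta>) \<bullet> b)) * x)) *
      complex_of_real (exp (- x\<^sup>2 / 2))" for b x
  have fh: "f b x = h b (x / (w \<bullet> b)) / complex_of_real (w \<bullet> b)" if "b \<in> Basis" for b x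
    using w[OF that]
    by (simp add: f_def h_def exp_of_real[symmetric] exp_add[symmetric] inner_diff_left algebra_simps)
  have "integrable lborel (f b)" if b: "b \<in> Basis" for b
  proof -
    have h: "integrable lborel (h b)"
      unfolding h_def by (rule integrable_gaussian_cis)
    have "integrable lborel (\<lambda>x. h b (0 + (1 / (w \<bullet> b)) * x) / complex_of_real (w \<bullet> b))"
      using w[OF b] by (intro integrable_divide_zero lborel_integrable_real_affine)
        (auto intro: h)
    moreover have "f b = (\<lambda>x. h b (0 + (1 / (w \<bullet> b)) * x) / complex_of_real (w \<bullet> b))"
      by (rule ext) (simp add: fh[OF b])
    ultimately show ?thesis
      by (simp only:)
  qed
  moreover have "(LINT x|lborel. f b x) = complex_of_real (sqrt (2 * pi) * exp (- ((w \<bullet> b) * ((\<zeta> - \<nu>) \<bullet> b))\<^sup>2 / 2))"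
    if b: "b \<in> Basis" for b
  proof -
    have "(LINT x|lborel. f b x) = (LINT x|lborel. h b (0 + (1 / (w \<bullet> b)) * x)) / complex_of_real (w \<bullet> b)"
      using fh[OF b] by simp
    also have "\<dots> = (LINT x|lborel. h b x)"
      using w[OF b] by (subst lborel_integral_real_affine[of "1 / (w \<bullet> b)" "h b" 0])
        (auto simp: scaleR_conv_of_real)
    also have "\<dots> = complex_of_real (sqrt (2 * pi) * exp (- ((w \<bullet> b) * ((\<nu> - \<zeta>) \<bullet> b))\<^sup>2 / 2))"
      unfolding h_def by (rule integral_gaussian_cis)
    also have "((w \<bullet> b) * ((\<nu> - \<zeta>) \<bullet> b))\<^sup>2 = ((w \<bullet> b) * ((\<zeta> - \<nu>) \<bullet> b))\<^sup>2"
      by (simp add: power2_eq_square inner_diff_left algebra_simps)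
    finally show ?thesis .
  qed
  moreover have "exp (- \<i> * complex_of_real (z \<bullet> \<zeta>)) * gaussian_packet w \<nu> z = (\<Prod>b\<in>Basis. f b (z \<bullet> b))" for z
    unfolding f_def prod.distrib gaussian_packet_def
    by (simp add: exp_sum[symmetric] euclidean_inner[of z \<zeta>] sum_distrib_left sum_negf)
  ultimately have "(LINT z|lborel. exp (- \<i> * complex_of_real (z \<bullet> \<zeta>)) * gaussian_packet w \<nu> z) =
      (\<Prod>b\<in>Basis. complex_of_real (sqrt (2 * pi) * exp (- ((w \<bullet> b) * ((\<zeta> - \<nu>) \<bullet> b))\<^sup>2 / 2)))"
    by (simp add: integral_lborel_prod)
  also have "\<dots> = complex_of_real (sqrt (2 * pi) ^ DIM('a)) *
      complex_of_real (exp (- (\<Sum>b\<in>Basis. ((w \<bullet> b) * ((\<zeta> - \<nu>) \<bullet> b))\<^sup>2) / 2))"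
    unfolding of_real_prod[symmetric] prod.distrib exp_sum[OF finite_Basis, symmetric] of_real_mult[symmetric]
    by (simp add: sum_negf sum_divide_distrib)
  finally show ?thesis
  proof -
    assume *: "(LINT z|lborel. exp (- \<i> * complex_of_real (z \<bullet> \<zeta>)) * gaussian_packet w \<nu> z) =
      complex_of_real (sqrt (2 * pi) ^ DIM('a)) *
      complex_of_real (exp (- (\<Sum>b\<in>Basis. ((w \<bullet> b) * ((\<zeta> - \<nu>) \<bullet> b))\<^sup>2) / 2))"
    \<comment> \<open>One factor sqrt(2 pi) from each coordinate cancels the unitary normalisation
      of the transform.\<close>
    have "(2 * pi) powr (- real DIM('a) / 2) * sqrt (2 * pi) ^ DIM('a) = 1"
      by (simp add: powr_half_sqrt[symmetric] powr_realpow[symmetric] powr_powr powr_add[symmetric])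
    then show ?thesis
      unfolding fourier_def * mult.assoc[symmetric] of_real_mult[symmetric] by simp
  qed
qed

section \<open>Polynomial factors and Gaussian decay\<close>

inductive_set coord_polynomials :: "('a::euclidean_space \<Rightarrow> complex) set" where
  const: "(\<lambda>_. c) \<in> coord_polynomials"
| coord: "(\<lambda>z. complex_of_real (z \<bullet> v)) \<in> coord_polynomials"
| add: "P \<in> coord_polynomials \<Longrightarrow> Q \<in> coord_polynomials \<Longrightarrow> (\<lambda>z. P z + Q z) \<in> coord_polynomials"
| mult: "P \<in> coord_polynomials \<Longrightarrow> Q \<in> coord_polynomials \<Longrightarrow> (\<lambda>z. P z * Q z) \<in> coord_polynomials"

lemma coord_polynomials_sum:
  "finite I \<Longrightarrow> (\<And>i. i \<in> I \<Longrightarrow> P i \<in> coord_polynomials) \<Longrightarrow>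
    (\<lambda>z. \<Sum>i\<in>I. P i z) \<in> coord_polynomials"
  by (induction I rule: finite_induct) (auto intro: coord_polynomials.intros)

text \<open>For iterated partial derivatives it matters that, with the direction \<open>v\<close>
  fixed, the derivative is again a polynomial in the base point. The product rule preserves
  this.\<close>

lemma coord_polynomials_derivative:
  assumes "P \<in> coord_polynomials"
  shows "\<exists>D. (\<forall>z. (P has_derivative D z) (at z)) \<and> (\<forall>v. (\<lambda>z. D z v) \<in> coord_polynomials)"
  using assms
proof induction
  case (const c)
  show ?case
    by (rule exI[of _ "\<lambda>_ _. 0"]) (auto intro: coord_polynomials.intros)
next
  case (coord v)
  show ?case
    by (rule exI[of _ "\<lambda>_ h. complex_of_real (h \<bullet> v)"])
       (auto intro!: coord_polynomials.intros derivative_eq_intros)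
next
  case (add P Q)
  then obtain D E where D: "\<And>z. (P has_derivative D z) (at z)" "\<And>v. (\<lambda>z. D z v) \<in> coord_polynomials"
    and E: "\<And>z. (Q has_derivative E z) (at z)" "\<And>v. (\<lambda>z. E z v) \<in> coord_polynomials"
    by blast
  show ?case
    by (rule exI[of _ "\<lambda>z h. D z h + E z h"])
       (auto intro!: coord_polynomials.add has_derivative_add D E)
next
  case (mult P Q)
  then obtain D E where D: "\<And>z. (P has_derivative D z) (at z)" "\<And>v. (\<lambda>z. D z v) \<in> coord_polynomials"
    and E: "\<And>z. (Q has_derivative E z) (at z)" "\<And>v. (\<lambda>z. E z v) \<in> coord_polynomials"
    by blast
  show ?case
    by (rule exI[of _ "\<lambda>z h. P z * E z h + D z h * Q z"])
       (auto intro!: coord_polynomials.add coord_polynomials.mult has_derivative_mult D E mult.hyps)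
qed

lemma coord_polynomials_growth:
  assumes "P \<in> coord_polynomials"
  shows "\<exists>K m. \<forall>z. norm (P z) \<le> K * (1 + norm z) ^ m"
  using assms
proof induction
  case (const c)
  show ?case
    by (rule exI[of _ "norm c"], rule exI[of _ 0]) simp
next
  case (coord v)
  have "\<bar>z \<bullet> v\<bar> \<le> norm v * (1 + norm z)" for z
    using Cauchy_Schwarz_ineq2[of z v] by (simp add: algebra_simps add_increasing)
  then show ?case
    by (intro exI[of _ "norm v"] exI[of _ 1]) simp
next
  case (add P Q)
  then obtain K m L n where *: "\<And>z. norm (P z) \<le> K * (1 + norm z) ^ m" "\<And>z. norm (Q z) \<le> L * (1 + norm z) ^ n"
    by blast
  have "norm (P z + Q z) \<le> (\<bar>K\<bar> + \<bar>L\<bar>) * (1 + norm z) ^ (m + n)" for z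
  proof -
    have "norm (P z + Q z) \<le> K * (1 + norm z) ^ m + L * (1 + norm z) ^ n"
      using norm_triangle_ineq[of "P z" "Q z"] *[of z] by linarith
    also have "\<dots> \<le> \<bar>K\<bar> * (1 + norm z) ^ (m + n) + \<bar>L\<bar> * (1 + norm z) ^ (m + n)"
      by (intro add_mono mult_mono power_increasing) auto
    finally show ?thesis
      by (simp add: algebra_simps)
  qed
  then show ?case by blast
next
  case (mult P Q)
  then obtain K m L n where *: "\<And>z. norm (P z) \<le> K * (1 + norm z) ^ m" "\<And>z. norm (Q z) \<le> L * (1 + norm z) ^ n"
    by blast
  have "norm (P z * Q z) \<le> (K * L) * (1 + norm z) ^ (m + n)" for z
  proof -
    have "norm (P z * Q z) \<le> (K * (1 + norm z) ^ m) * (L * (1 + norm z) ^ n)"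
      unfolding norm_mult by (intro mult_mono * norm_ge_zero order_trans[OF norm_ge_zero *(1)])
    then show ?thesis
      by (simp add: algebra_simps power_add)
  qed
  then show ?case by blast
qed

text \<open>The left side divided by n! is a single term of the exponential series, whose terms are
  all nonnegative.\<close>

lemma power_le_fact_mult_exp:
  fixes x :: real
  assumes "0 \<le> x"
  shows "x ^ n \<le> fact n * exp x"
proof -
  have "x ^ n / fact n \<le> (\<Sum>k. x ^ k / fact k)"
    using sum_le_suminf[of "\<lambda>k. x ^ k / fact k" "{n}"] summable_exp[of x] assms
    by (simp add: field_simps)
  then show ?thesis
    by (simp add: exp_def scaleR_conv_of_real field_simps)
qed

text \<open>The polynomial is dominated by n! exp(1 + r), and completing the square bounds the
  remaining exponent r - c r^2 by 1/(4c).\<close>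

lemma power_mult_gaussian_le:
  fixes r c :: real
  assumes "0 < c" "0 \<le> r"
  shows "(1 + r) ^ n * exp (- c * r\<^sup>2) \<le> fact n * exp (1 + 1 / (4 * c))"
proof -
  have "r - c * r\<^sup>2 = 1 / (4 * c) - c * (r - 1 / (2 * c))\<^sup>2"
    using assms by (simp add: power2_eq_square field_simps)
  also have "\<dots> \<le> 1 / (4 * c)"
    using assms by simp
  finally have le: "1 + r - c * r\<^sup>2 \<le> 1 + 1 / (4 * c)" by simp
  have "(1 + r) ^ n * exp (- c * r\<^sup>2) \<le> fact n * exp (1 + r) * exp (- c * r\<^sup>2)"
    using assms by (intro mult_right_mono power_le_fact_mult_exp) auto
  also have "\<dots> = fact n * exp (1 + r - c * r\<^sup>2)"
    by (simp add: exp_diff exp_minus exp_add field_simps)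
  also have "\<dots> \<le> fact n * exp (1 + 1 / (4 * c))"
    using le by simp
  finally show ?thesis .
qed

section \<open>Derivatives and rapid decay of packets\<close>

lemma gaussian_packet_exp:
  "gaussian_packet w \<nu> z = (\<Prod>b\<in>Basis. 1 / complex_of_real (w \<bullet> b)) *
     exp (\<Sum>b\<in>Basis. \<i> * complex_of_real ((\<nu> \<bullet> b) * (z \<bullet> b)) - complex_of_real (((z \<bullet> b) / (w \<bullet> b))\<^sup>2 / 2))"
  by (simp add: gaussian_packet_def exp_sum prod_dividef)

lemma norm_gaussian_packet:
  assumes w: "\<And>b. b \<in> Basis \<Longrightarrow> 0 < w \<bullet> b"
  shows "norm (gaussian_packet w \<nu> z) =
    (\<Prod>b\<in>Basis. 1 / (w \<bullet> b)) * exp (- (\<Sum>b\<in>Basis. ((z \<bullet> b) / (w \<bullet> b))\<^sup>2) / 2)"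
  using w
  by (auto simp: gaussian_packet_exp norm_mult prod_norm[symmetric] norm_divide sum_negf sum_divide_distrib less_imp_le
      intro!: prod.cong)

text \<open>The logarithmic derivative of the packet is written in the shape that makes it a
  coordinate polynomial in \<open>z\<close> for each fixed direction.\<close>

lemma has_derivative_gaussian_packet:
  assumes w: "\<And>b. b \<in> Basis \<Longrightarrow> 0 < w \<bullet> b"
  shows "(gaussian_packet w \<nu> has_derivative (\<lambda>h. gaussian_packet w \<nu> z *
      (\<Sum>b\<in>Basis. complex_of_real (h \<bullet> b) *
        (\<i> * complex_of_real (\<nu> \<bullet> b) + complex_of_real (- 1 / (w \<bullet> b)\<^sup>2) * complex_of_real (z \<bullet> b)))))
    (at z)"
proof -
  let ?E = "\<lambda>z. \<Sum>b\<in>Basis. \<i> * complex_of_real ((\<nu> \<bullet> b) * (z \<bullet> b)) - complex_of_real (((z \<bullet> b) / (w \<bullet> b))\<^sup>2 / 2)"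
  let ?D = "\<lambda>h. \<Sum>b\<in>Basis. complex_of_real (h \<bullet> b) *
        (\<i> * complex_of_real (\<nu> \<bullet> b) + complex_of_real (- 1 / (w \<bullet> b)\<^sup>2) * complex_of_real (z \<bullet> b))"
  have "(?E has_derivative ?D) (at z)"
    by (auto intro!: has_derivative_sum derivative_eq_intros dest!: w simp: power2_eq_square field_simps)
  then have "((\<lambda>z. exp (?E z)) has_derivative (\<lambda>h. exp (?E z) * ?D h)) (at z)"
    by (rule has_derivative_compose[OF _ DERIV_exp[unfolded has_field_derivative_def]])
  from has_derivative_mult_right[OF this, of "\<Prod>b\<in>Basis. 1 / complex_of_real (w \<bullet> b)"] show ?thesis
    by (simp add: gaussian_packet_exp[abs_def] mult.assoc)
qed

text \<open>Each iterated partial derivative is a polynomial times the packet itself, so polynomial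
  growth competes only with Gaussian decay.\<close>

lemma schwartz_gaussian_packet:
  fixes w \<nu> :: "'a::euclidean_space"
  assumes w: "\<And>b. b \<in> Basis \<Longrightarrow> 0 < w \<bullet> b"
  shows "schwartz (gaussian_packet w \<nu>)"
proof -
  let ?G = "gaussian_packet w \<nu>"
  define L where "L v z = (\<Sum>b\<in>Basis. complex_of_real (v \<bullet> b) * (\<i> * complex_of_real (\<nu> \<bullet> b) +
      complex_of_real (- 1 / (w \<bullet> b)\<^sup>2) * complex_of_real (z \<bullet> b)))" for v z :: 'a
  have L: "L v \<in> coord_polynomials" for v
    unfolding L_def by (intro coord_polynomials_sum coord_polynomials.intros) simp
  have dG: "(?G has_derivative (\<lambda>h. ?G z * L h z)) (at z)" for z
    unfolding L_def using w by (rule has_derivative_gaussian_packet)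
  have step: "\<exists>Q. (\<forall>v. Q v \<in> coord_polynomials) \<and>
      (\<forall>z. ((\<lambda>z. P z * ?G z) has_derivative (\<lambda>v. Q v z * ?G z)) (at z))"
    if P: "P \<in> coord_polynomials" for P
  proof -
    obtain D where D: "\<And>z. (P has_derivative D z) (at z)" "\<And>v. (\<lambda>z. D z v) \<in> coord_polynomials"
      using coord_polynomials_derivative[OF P] by blast
    have "((\<lambda>z. P z * ?G z) has_derivative (\<lambda>v. (P z * L v z + D z v) * ?G z)) (at z)" for z
      using has_derivative_mult[OF D(1) dG, of z] by (simp add: algebra_simps)
    moreover have "(\<lambda>z. P z * L v z + D z v) \<in> coord_polynomials" for v
      by (intro coord_polynomials.add coord_polynomials.mult P L D)
    ultimately show ?thesis
      by (intro exI[of _ "\<lambda>v z. P z * L v z + D z v"]) blast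
  qed
  have iter: "\<exists>P\<in>coord_polynomials. iterated_partial vs ?G = (\<lambda>z. P z * ?G z)" for vs
  proof (induction vs)
    case Nil
    show ?case
      by (rule bexI[OF _ coord_polynomials.const[of 1]]) simp
  next
    case (Cons v vs)
    then obtain P where P: "P \<in> coord_polynomials" "iterated_partial vs ?G = (\<lambda>z. P z * ?G z)"
      by blast
    obtain Q where Q: "\<And>v. Q v \<in> coord_polynomials"
      "\<And>z. ((\<lambda>z. P z * ?G z) has_derivative (\<lambda>v. Q v z * ?G z)) (at z)"
      using step[OF P(1)] by blast
    have "iterated_partial (v # vs) ?G = (\<lambda>z. Q v z * ?G z)"
      by (simp add: P(2) fun_eq_iff frechet_derivative_at[OF Q(2), symmetric])
    then show ?case
      using Q(1) by blast
  qed
  \<comment> \<open>Every width is at most \<open>norm w\<close>. Replacing all widths by this one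
    number gives an isotropic Gaussian majorant with rate \<open>c\<close>.\<close>
  define c where "c = 1 / (2 * (norm w)\<^sup>2)"
  define A where "A = (\<Prod>b\<in>Basis. 1 / (w \<bullet> b))"
  have "w \<noteq> 0"
    using w by (metis SOME_Basis inner_zero_left less_irrefl)
  then have c: "0 < c" by (simp add: c_def)
  have A: "0 \<le> A"
    unfolding A_def using w by (intro prod_nonneg) (auto simp: less_imp_le)
  have bound: "norm (?G z) \<le> A * exp (- c * (norm z)\<^sup>2)" for z
  proof -
    have "c * (norm z)\<^sup>2 = (\<Sum>b\<in>Basis. (z \<bullet> b)\<^sup>2 / (norm w)\<^sup>2) / 2"
      by (subst euclidean_inner[of z z, folded power2_norm_eq_inner power2_eq_square])
        (simp add: c_def sum_divide_distrib mult.commute)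
    also have "\<dots> \<le> (\<Sum>b\<in>Basis. ((z \<bullet> b) / (w \<bullet> b))\<^sup>2) / 2"
    proof (intro divide_right_mono sum_mono)
      fix b :: 'a assume b: "b \<in> Basis"
      show "(z \<bullet> b)\<^sup>2 / (norm w)\<^sup>2 \<le> ((z \<bullet> b) / (w \<bullet> b))\<^sup>2"
        unfolding power_divide using w[OF b] Basis_le_norm[OF b, of w]
        by (intro divide_left_mono power_mono mult_pos_pos) auto
    qed simp
    finally show ?thesis
      using A by (simp add: norm_gaussian_packet w A_def[symmetric] mult_left_mono)
  qed
  show ?thesis
    unfolding schwartz_def
  proof (intro allI impI conjI)
    fix vs :: "'a list"
    obtain P where P: "P \<in> coord_polynomials" "iterated_partial vs ?G = (\<lambda>z. P z * ?G z)"
      using iter by blast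
    show "iterated_partial vs ?G differentiable (at z)" for z
      using step[OF P(1)] unfolding P(2) differentiable_def by blast
    fix k
    obtain K m where K: "\<And>z. norm (P z) \<le> K * (1 + norm z) ^ m"
      using coord_polynomials_growth[OF P(1)] by blast
    have "norm z ^ k * norm (iterated_partial vs ?G z) \<le>
        \<bar>K\<bar> * A * (fact (k + m) * exp (1 + 1 / (4 * c)))" for z
    proof -
      have "norm z ^ k * norm (iterated_partial vs ?G z) \<le>
          (1 + norm z) ^ k * ((\<bar>K\<bar> * (1 + norm z) ^ m) * (A * exp (- c * (norm z)\<^sup>2)))"
        unfolding P(2) norm_mult
        by (intro mult_mono power_mono bound order_trans[OF K] mult_right_mono) (auto simp: A)
      also have "\<dots> = \<bar>K\<bar> * A * ((1 + norm z) ^ (k + m) * exp (- c * (norm z)\<^sup>2))"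
        by (simp add: power_add)
      also have "\<dots> \<le> \<bar>K\<bar> * A * (fact (k + m) * exp (1 + 1 / (4 * c)))"
        using A by (intro mult_left_mono power_mult_gaussian_le c) auto
      finally show ?thesis .
    qed
    then show "\<exists>B. \<forall>z. norm z ^ k * norm (iterated_partial vs ?G z) \<le> B"
      by blast
  qed
qed

section \<open>Sobolev norms of anisotropic packets\<close>

text \<open>The sum of the basis vectors is the all-ones vector, so the width is \<alpha> in x and
  \<beta> in each coordinate of y. The central frequency lies on the \<xi>-axis at distance
  \<open>N\<close> from the origin when \<open>N\<close> is nonnegative.\<close>

definition anisotropic_packet :: "real \<Rightarrow> real \<Rightarrow> real \<Rightarrow> real \<times> (real ^ 'n) \<Rightarrow> complex" where
  "anisotropic_packet \<alpha> \<beta> N = gaussian_packet (\<alpha>, \<beta> *\<^sub>R (\<Sum>b\<in>Basis. b)) (N, 0)"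

lemma
  shows prod_Basis_prod_eq: "prod f (Basis :: ('a::euclidean_space \<times> 'b::euclidean_space) set) =
      (\<Prod>i\<in>Basis. f (i, 0)) * (\<Prod>i\<in>Basis. f (0, i))"
    and sum_Basis_Times_eq: "sum g (Basis :: ('a \<times> 'b) set) =
      (\<Sum>i\<in>Basis. g (i, 0)) + (\<Sum>i\<in>Basis. g (0, i))"
proof -
  have inj: "inj_on (\<lambda>u. (u::'a, 0::'b)) Basis" "inj_on (\<lambda>u. (0::'a, u::'b)) Basis"
    by (auto intro!: inj_onI)
  then show "prod f (Basis :: ('a \<times> 'b) set) = (\<Prod>i\<in>Basis. f (i, 0)) * (\<Prod>i\<in>Basis. f (0, i))"
    unfolding Basis_prod_def
    by (subst prod.union_disjoint) (auto simp: Basis_prod_def prod.reindex)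
  from inj show "sum g (Basis :: ('a \<times> 'b) set) = (\<Sum>i\<in>Basis. g (i, 0)) + (\<Sum>i\<in>Basis. g (0, i))"
    unfolding Basis_prod_def
    by (subst sum.union_disjoint) (auto simp: Basis_prod_def sum.reindex)
qed

lemma anisotropic_weight_pos:
  fixes \<alpha> \<beta> :: real
  assumes "0 < \<alpha>" "0 < \<beta>" "b \<in> Basis"
  shows "0 < (\<alpha>, \<beta> *\<^sub>R (\<Sum>b\<in>Basis. b) :: real ^ 'n) \<bullet> b"
  using assms by (auto simp: Basis_prod_def)

lemma schwartz_anisotropic_packet:
  "0 < \<alpha> \<Longrightarrow> 0 < \<beta> \<Longrightarrow> schwartz (anisotropic_packet \<alpha> \<beta> N :: real \<times> (real ^ 'n) \<Rightarrow> complex)"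
  unfolding anisotropic_packet_def by (intro schwartz_gaussian_packet anisotropic_weight_pos)

lemma fourier_anisotropic_packet:
  fixes \<eta> :: "real ^ 'n"
  assumes "0 < \<alpha>" "0 < \<beta>"
  shows "fourier (anisotropic_packet \<alpha> \<beta> N) (\<xi>, \<eta>) =
    complex_of_real (exp (- ((\<alpha> * (\<xi> - N))\<^sup>2 + (\<beta> * norm \<eta>)\<^sup>2) / 2))"
proof -
  have "(\<Sum>b\<in>Basis. (((\<alpha>, \<beta> *\<^sub>R (\<Sum>b\<in>Basis. b) :: real ^ 'n) \<bullet> b) * (((\<xi>, \<eta>) - (N, 0)) \<bullet> b))\<^sup>2) =
      (\<alpha> * (\<xi> - N))\<^sup>2 + (\<Sum>b\<in>Basis. (\<beta> * (\<eta> \<bullet> b))\<^sup>2)"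
    by (simp add: sum_Basis_Times_eq)
  also have "(\<Sum>b\<in>Basis. (\<beta> * (\<eta> \<bullet> b))\<^sup>2) = (\<beta> * norm \<eta>)\<^sup>2"
    unfolding power_mult_distrib sum_distrib_left[symmetric]
    by (subst euclidean_inner[of \<eta> \<eta>, folded power2_norm_eq_inner power2_eq_square]) simp
  finally show ?thesis
    unfolding anisotropic_packet_def
    by (subst fourier_gaussian_packet) (use assms anisotropic_weight_pos in auto)
qed

text \<open>The substitution \<xi> = N + a/\<alpha>, \<eta> = b/\<beta> turns the Fourier transform
  of a packet into the standard Gaussian in (a, b), so that all dependence on the parameters moves
  into the prefactor, the Sobolev weight and the phase.\<close>

lemma
  assumes "0 < \<alpha>" "0 < \<beta>"
  shows integral_lborel_anisotropic_affine:
      "f \<in> borel_measurable borel \<Longrightarrow>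
        (LINT \<zeta>|lborel. (f :: real \<times> (real ^ 'n) \<Rightarrow> complex) \<zeta>) = complex_of_real (1 / (\<alpha> * \<beta> ^ CARD('n))) *
          (LINT z|lborel. f (N + fst z / \<alpha>, snd z /\<^sub>R \<beta>))"
    and nn_integral_lborel_anisotropic_affine:
      "g \<in> borel_measurable borel \<Longrightarrow>
        (\<integral>\<^sup>+\<zeta>. (g :: real \<times> (real ^ 'n) \<Rightarrow> ennreal) \<zeta> \<partial>lborel) = ennreal (1 / (\<alpha> * \<beta> ^ CARD('n))) *
          (\<integral>\<^sup>+z. g (N + fst z / \<alpha>, snd z /\<^sub>R \<beta>) \<partial>lborel)"
proof -
  define w where "w b = 1 / ((\<alpha>, \<beta> *\<^sub>R (\<Sum>b\<in>Basis. b) :: real ^ 'n) \<bullet> b)" for b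
  have w: "0 < w b" if "b \<in> Basis" for b
    unfolding w_def using anisotropic_weight_pos[OF assms that] by simp
  have prod: "(\<Prod>b\<in>Basis. w b) = 1 / (\<alpha> * \<beta> ^ CARD('n))"
    by (simp add: w_def prod_Basis_prod_eq power_one_over)
  have affine: "(N, 0) + (\<Sum>b\<in>Basis. (w b * (z \<bullet> b)) *\<^sub>R b) = (N + fst z / \<alpha>, snd z /\<^sub>R \<beta>)" for z
  proof -
    have "(\<Sum>b\<in>Basis. ((snd z \<bullet> b) / \<beta>) *\<^sub>R b) = inverse \<beta> *\<^sub>R (\<Sum>b\<in>Basis. (snd z \<bullet> b) *\<^sub>R b)"
      by (simp add: scaleR_sum_right divide_inverse mult.commute)
    then have *: "(\<Sum>b\<in>Basis. ((snd z \<bullet> b) / \<beta>) *\<^sub>R b) = snd z /\<^sub>R \<beta>"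
      by (simp add: euclidean_representation)
    have "(\<Sum>b\<in>Basis. (w b * (z \<bullet> b)) *\<^sub>R b) =
        (fst z / \<alpha>, 0) + (\<Sum>b\<in>Basis. (0, ((snd z \<bullet> b) / \<beta>) *\<^sub>R b))"
      by (simp add: sum_Basis_Times_eq w_def inner_prod_def)
    also have "(\<Sum>b\<in>Basis. (0::real, ((snd z \<bullet> b) / \<beta>) *\<^sub>R b)) = (0, snd z /\<^sub>R \<beta>)"
      unfolding sum_prod * by simp
    finally show ?thesis
      by simp
  qed
  show "f \<in> borel_measurable borel \<Longrightarrow>
        (LINT \<zeta>|lborel. (f :: real \<times> (real ^ 'n) \<Rightarrow> complex) \<zeta>) = complex_of_real (1 / (\<alpha> * \<beta> ^ CARD('n))) *
          (LINT z|lborel. f (N + fst z / \<alpha>, snd z /\<^sub>R \<beta>))"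
    using integral_lborel_affine_Basis[of w f "(N, 0)"] w by (simp add: prod affine scaleR_conv_of_real)
  show "g \<in> borel_measurable borel \<Longrightarrow>
        (\<integral>\<^sup>+\<zeta>. (g :: real \<times> (real ^ 'n) \<Rightarrow> ennreal) \<zeta> \<partial>lborel) = ennreal (1 / (\<alpha> * \<beta> ^ CARD('n))) *
          (\<integral>\<^sup>+z. g (N + fst z / \<alpha>, snd z /\<^sub>R \<beta>) \<partial>lborel)"
    using nn_integral_lborel_affine_Basis[of w g "(N, 0)"] w by (simp add: prod affine)
qed

lemma integrable_power_mult_gaussian:
  "integrable lborel (\<lambda>z::'a::euclidean_space. (1 + norm z) ^ m * exp (- (norm z)\<^sup>2 / 2))"
proof (rule Bochner_Integration.integrable_bound)
  let ?B = "fact m * exp (1 + 1 / (4 * (1 / 4))) :: real"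
  show "integrable lborel (\<lambda>z::'a. ?B * exp (- (1 / 4) * (norm z)\<^sup>2))"
    by (intro integrable_mult_right integrable_exp_neg_norm_square) simp
  have "(1 + norm z) ^ m * exp (- (norm z)\<^sup>2 / 2) \<le> ?B * exp (- (1 / 4) * (norm z)\<^sup>2)" for z :: 'a
  proof -
    \<comment> \<open>One half of the Gaussian absorbs the polynomial; the other half stays as an
      integrable majorant.\<close>
    have "exp (- (norm z)\<^sup>2 / 2) = exp (- (1 / 4) * (norm z)\<^sup>2) * exp (- (1 / 4) * (norm z)\<^sup>2)"
      by (simp add: exp_add[symmetric])
    then show ?thesis
      using mult_right_mono[OF power_mult_gaussian_le[of "1/4" "norm z" m], of "exp (- (1 / 4) * (norm z)\<^sup>2)"]
      by (simp add: mult.assoc)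
  qed
  then show "AE z in lborel. norm ((1 + norm z) ^ m * exp (- (norm z)\<^sup>2 / 2)) \<le>
      norm (?B * exp (- (1 / 4) * (norm (z::'a))\<^sup>2))"
    by (intro AE_I2) (simp add: abs_mult)
qed measurable

section \<open>Powers of extended reals and bounds for Sobolev norms\<close>

lemma ennreal_rpow_mono:
  assumes "a \<le> b" "0 < r"
  shows "ennreal_rpow a r \<le> ennreal_rpow b r"
proof (cases "b = \<infinity>")
  case False
  then have "a < \<infinity>" "b < \<infinity>"
    using assms by (auto simp: top.not_eq_extremum intro: le_less_trans)
  then show ?thesis
    using assms by (auto simp: ennreal_rpow_def intro!: ennreal_leI powr_mono2 enn2real_mono)
qed (simp add: ennreal_rpow_def)

lemma ennreal_rpow_ennreal: "0 \<le> v \<Longrightarrow> ennreal_rpow (ennreal v) r = ennreal (v powr r)"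
  by (simp add: ennreal_rpow_def)

lemma sobolev_norm_mono:
  assumes "s \<le> s'"
  shows "sobolev_norm s f \<le> sobolev_norm s' f"
  unfolding sobolev_norm_def
  by (intro ennreal_rpow_mono nn_integral_mono ennreal_leI mult_right_mono powr_mono assms) auto

text \<open>\<open>M\<close> bounds the frequency scale of the packet: the centre \<open>N\<close>
  and the spreads 1/\<alpha>, 1/\<beta> are at most \<open>M\<close>, so the weight costs M^s up to
  Gaussian tails. The square root in the denominator is the L^2 norm of a bump of height 1 on a
  frequency box of volume comparable to 1/(\<alpha> \<beta>^n), with n the dimension of y.\<close>

lemma sobolev_norm_anisotropic_packet_le:
  fixes s :: real
  assumes s: "0 \<le> s"
  shows "\<exists>K>0. \<forall>\<alpha> \<beta> N M. 0 < \<alpha> \<longrightarrow> 0 < \<beta> \<longrightarrow> 1 \<le> M \<longrightarrow> \<bar>N\<bar> \<le> M \<longrightarrow> 1 \<le> M * \<alpha> \<longrightarrow> 1 \<le> M * \<beta> \<longrightarrow>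
    sobolev_norm s (anisotropic_packet \<alpha> \<beta> N :: real \<times> (real ^ 'n) \<Rightarrow> complex) \<le>
      ennreal (K * M powr s / sqrt (\<alpha> * \<beta> ^ CARD('n)))"
proof -
  \<comment> \<open>An integer above 2s, so that the weight in the rescaled variable is controlled
    by a natural power of 1 + |z|.\<close>
  define m where "m = nat \<lceil>2 * s\<rceil>"
  define J where "J = (LINT z|lborel. (1 + norm (z :: real \<times> (real ^ 'n))) ^ m * exp (- (norm z)\<^sup>2 / 2))"
  \<comment> \<open>The factor 3^s comes from 1 + |\<zeta>|^2 <= 3 M^2 (1 + |z|^2) for the rescaled
    frequency \<zeta>. Adding 1 to \<open>J\<close> secures positivity at once. The final constant
    is \<open>sqrt K\<close>, since the norm is a square root.\<close>
  define K where "K = 3 powr s * (J + 1)"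
  have J: "0 \<le> J"
    unfolding J_def by (intro integral_nonneg_AE AE_I2) simp
  then have K: "0 < K"
    by (simp add: K_def)
  have "sobolev_norm s (anisotropic_packet \<alpha> \<beta> N :: real \<times> (real ^ 'n) \<Rightarrow> complex) \<le>
      ennreal (sqrt K * M powr s / sqrt (\<alpha> * \<beta> ^ CARD('n)))"
    if \<alpha>: "0 < \<alpha>" and \<beta>: "0 < \<beta>" and M: "1 \<le> M" "\<bar>N\<bar> \<le> M" "1 \<le> M * \<alpha>" "1 \<le> M * \<beta>"
    for \<alpha> \<beta> N M :: real
  proof -
    let ?u = "anisotropic_packet \<alpha> \<beta> N :: real \<times> (real ^ 'n) \<Rightarrow> complex"
    let ?A = "\<alpha> * \<beta> ^ CARD('n)"
    have A: "0 < ?A" using \<alpha> \<beta> by simp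
    have fu: "fourier ?u = (\<lambda>\<zeta>. complex_of_real (exp (- ((\<alpha> * (fst \<zeta> - N))\<^sup>2 + (\<beta> * norm (snd \<zeta>))\<^sup>2) / 2)))"
      using fourier_anisotropic_packet[OF \<alpha> \<beta>] by (auto simp: fun_eq_iff)
    have [measurable]: "fourier ?u \<in> borel_measurable borel"
      unfolding fu by (intro borel_measurable_continuous_onI continuous_intros) auto
    have pt: "(1 + (norm (N + fst z / \<alpha>, snd z /\<^sub>R \<beta>))\<^sup>2) powr s *
        (norm (fourier ?u (N + fst z / \<alpha>, snd z /\<^sub>R \<beta>)))\<^sup>2 \<le>
        (M powr s)\<^sup>2 * 3 powr s * ((1 + norm z) ^ m * exp (- (norm z)\<^sup>2 / 2))"
      for z :: "real \<times> (real ^ 'n)"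
    proof -
      obtain a b where z: "z = (a, b)" by (cases z)
      have n: "(norm z)\<^sup>2 = a\<^sup>2 + (norm b)\<^sup>2"
        by (simp add: z norm_Pair)
      have "norm (fourier ?u (N + fst z / \<alpha>, snd z /\<^sub>R \<beta>)) = exp (- (norm z)\<^sup>2 / 2)"
        unfolding fu n using \<alpha> \<beta> by (simp add: z)
      moreover have "(exp (- (norm z)\<^sup>2 / 2))\<^sup>2 \<le> exp (- (norm z)\<^sup>2 / 2)"
        by (simp add: power2_eq_square exp_add[symmetric] mult_le_one mult_left_le)
      ultimately have 1: "(norm (fourier ?u (N + fst z / \<alpha>, snd z /\<^sub>R \<beta>)))\<^sup>2 \<le> exp (- (norm z)\<^sup>2 / 2)"
        by simp
      have ia: "\<bar>a / \<alpha>\<bar> \<le> M * \<bar>a\<bar>"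
        using mult_right_mono[OF M(3), of "\<bar>a\<bar>"] \<alpha> by (simp add: abs_divide field_simps)
      have ib: "norm b / \<beta> \<le> M * norm b"
        using mult_right_mono[OF M(4), of "norm b"] \<beta> by (simp add: field_simps)
      have "(N + a / \<alpha>)\<^sup>2 \<le> 2 * N\<^sup>2 + 2 * (a / \<alpha>)\<^sup>2"
        using zero_le_power2[of "N - a / \<alpha>"] by (simp add: power2_sum power2_diff)
      also have "\<dots> \<le> 2 * M\<^sup>2 + 2 * (M * \<bar>a\<bar>)\<^sup>2"
        using M(1,2) ia by (intro add_mono mult_left_mono) (auto simp flip: abs_le_square_iff)
      finally have "(N + a / \<alpha>)\<^sup>2 \<le> 2 * M\<^sup>2 + 2 * M\<^sup>2 * a\<^sup>2"
        by (simp add: power_mult_distrib)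
      moreover have "(norm b / \<beta>)\<^sup>2 \<le> M\<^sup>2 * (norm b)\<^sup>2"
        using power_mono[OF ib, of 2] \<beta> by (simp add: power_mult_distrib)
      moreover have "1 \<le> M\<^sup>2"
        using M(1) by simp
      moreover have "0 \<le> M\<^sup>2 * a\<^sup>2" "0 \<le> M\<^sup>2 * (norm b)\<^sup>2"
        by simp_all
      moreover have "(norm (N + fst z / \<alpha>, snd z /\<^sub>R \<beta>))\<^sup>2 = (N + a / \<alpha>)\<^sup>2 + (norm b / \<beta>)\<^sup>2"
        using \<beta> by (simp add: z norm_Pair divide_inverse mult.commute)
      moreover have "M\<^sup>2 * 3 * (1 + (norm z)\<^sup>2) = 3 * M\<^sup>2 + 3 * (M\<^sup>2 * a\<^sup>2) + 3 * (M\<^sup>2 * (norm b)\<^sup>2)"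
        by (simp add: n algebra_simps)
      ultimately have "1 + (norm (N + fst z / \<alpha>, snd z /\<^sub>R \<beta>))\<^sup>2 \<le> M\<^sup>2 * 3 * (1 + (norm z)\<^sup>2)"
        by linarith
      also have "\<dots> \<le> M\<^sup>2 * 3 * (1 + norm z)\<^sup>2"
        by (intro mult_left_mono) (auto simp: power2_sum)
      finally have "(1 + (norm (N + fst z / \<alpha>, snd z /\<^sub>R \<beta>))\<^sup>2) powr s \<le> (M\<^sup>2 * 3 * (1 + norm z)\<^sup>2) powr s"
        by (intro powr_mono2 s) auto
      also have "\<dots> = (M powr s)\<^sup>2 * 3 powr s * (1 + norm z) powr (2 * s)"
        using M(1) by (simp add: powr_mult power2_eq_square powr_add[symmetric])
      also have "(1 + norm z) powr (2 * s) \<le> (1 + norm z) powr real m"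
        unfolding m_def by (intro powr_mono) (auto simp: real_nat_ceiling_ge)
      also have "(1 + norm z) powr real m = (1 + norm z) ^ m"
        by (rule powr_realpow) (simp add: add_pos_nonneg)
      finally have "(1 + (norm (N + fst z / \<alpha>, snd z /\<^sub>R \<beta>))\<^sup>2) powr s \<le> (M powr s)\<^sup>2 * 3 powr s * (1 + norm z) ^ m"
        by (simp add: mult_left_mono)
      from mult_mono[OF this 1] show ?thesis
        by (simp add: mult.assoc)
    qed
    have "(\<integral>\<^sup>+ \<zeta>. ennreal ((1 + (norm \<zeta>)\<^sup>2) powr s * (norm (fourier ?u \<zeta>))\<^sup>2) \<partial>lborel) =
        ennreal (1 / ?A) * (\<integral>\<^sup>+ z. ennreal ((1 + (norm (N + fst z / \<alpha>, snd z /\<^sub>R \<beta>))\<^sup>2) powr s *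
        (norm (fourier ?u (N + fst z / \<alpha>, snd z /\<^sub>R \<beta>)))\<^sup>2) \<partial>lborel)"
      by (rule nn_integral_lborel_anisotropic_affine[OF \<alpha> \<beta>]) measurable
    also have "\<dots> \<le> ennreal (1 / ?A) * (\<integral>\<^sup>+ z. ennreal ((M powr s)\<^sup>2 * 3 powr s *
        ((1 + norm z) ^ m * exp (- (norm (z :: real \<times> (real ^ 'n)))\<^sup>2 / 2))) \<partial>lborel)"
      by (intro mult_left_mono nn_integral_mono ennreal_leI pt) auto
    also have "\<dots> = ennreal (1 / ?A) * ennreal ((M powr s)\<^sup>2 * 3 powr s * J)"
      unfolding J_def
      by (subst nn_integral_eq_integral) (intro integrable_mult_right integrable_power_mult_gaussian, simp_all)
    also have "\<dots> \<le> ennreal (K * (M powr s)\<^sup>2 / ?A)"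
      using A J by (subst ennreal_mult'[symmetric]) (auto simp: K_def field_simps intro!: ennreal_leI divide_right_mono mult_left_mono)
    finally have "sobolev_norm s ?u \<le> ennreal_rpow (ennreal (K * (M powr s)\<^sup>2 / ?A)) (1 / 2)"
      unfolding sobolev_norm_def by (intro ennreal_rpow_mono) auto
    also have "\<dots> = ennreal (sqrt (K * (M powr s)\<^sup>2 / ?A))"
      using K A by (simp add: ennreal_rpow_ennreal powr_half_sqrt)
    also have "sqrt (K * (M powr s)\<^sup>2 / ?A) = sqrt K * M powr s / sqrt ?A"
      by (simp add: real_sqrt_mult real_sqrt_divide)
    finally show ?thesis .
  qed
  then show ?thesis
    using K by (intro exI[of _ "sqrt K"]) auto
qed

section \<open>Propagation of packets\<close>

lemma norm_iexp_diff_one_le: "norm (exp (\<i> * complex_of_real x) - 1) \<le> \<bar>x\<bar>"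
  using iexp_approx1[of x 0] by simp

text \<open>The dispersion relation is expanded exactly around (N, 0). The constant term gives a
  unimodular factor, the linear term moves x by 3 N^2 t (the group velocity), and the terms
  multiplied by \<open>t\<close> in \<phi> are the quadratic and cubic remainder responsible for
  dispersion.\<close>

lemma linear_group_anisotropic_packet:
  fixes t x N :: real and y :: "real ^ 'n"
  assumes \<alpha>: "0 < \<alpha>" and \<beta>: "0 < \<beta>"
  defines "\<phi> \<equiv> \<lambda>z. fst z * (x + 3 * N\<^sup>2 * t) / \<alpha> + (y \<bullet> snd z) / \<beta> +
    t * (3 * N * (fst z)\<^sup>2 / \<alpha>\<^sup>2 + fst z ^ 3 / \<alpha> ^ 3 + N * (norm (snd z))\<^sup>2 / \<beta>\<^sup>2 +
      fst z * (norm (snd z))\<^sup>2 / (\<alpha> * \<beta>\<^sup>2))"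
  shows "norm (linear_group t (anisotropic_packet \<alpha> \<beta> N) (x, y)) =
    (2 * pi) powr (- real (CARD('n) + 1) / 2) / (\<alpha> * \<beta> ^ CARD('n)) *
      norm (LINT z|lborel. exp (\<i> * complex_of_real (\<phi> z)) * complex_of_real (exp (- (norm z)\<^sup>2 / 2)))"
proof -
  let ?u = "anisotropic_packet \<alpha> \<beta> N :: real \<times> (real ^ 'n) \<Rightarrow> complex"
  define F where "F \<zeta> = exp (\<i> * complex_of_real ((x, y) \<bullet> \<zeta>)) *
    (exp (\<i> * complex_of_real (t * (fst \<zeta> * ((fst \<zeta>)\<^sup>2 + (norm (snd \<zeta>))\<^sup>2)))) * fourier ?u \<zeta>)" for \<zeta>
  have fu: "fourier ?u = (\<lambda>\<zeta>. complex_of_real (exp (- ((\<alpha> * (fst \<zeta> - N))\<^sup>2 + (\<beta> * norm (snd \<zeta>))\<^sup>2) / 2)))"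
    using fourier_anisotropic_packet[OF \<alpha> \<beta>] by (auto simp: fun_eq_iff)
  have F: "F \<in> borel_measurable borel"
    unfolding F_def fu by (intro borel_measurable_continuous_onI continuous_intros) auto
  have FT: "F (N + fst z / \<alpha>, snd z /\<^sub>R \<beta>) = exp (\<i> * complex_of_real (x * N + t * N ^ 3)) *
      (exp (\<i> * complex_of_real (\<phi> z)) * complex_of_real (exp (- (norm z)\<^sup>2 / 2)))" for z
  proof -
    obtain a b where z: "z = (a, b)" by (cases z)
    have "(x, y) \<bullet> (N + a / \<alpha>, b /\<^sub>R \<beta>) + t * ((N + a / \<alpha>) * ((N + a / \<alpha>)\<^sup>2 + (norm (b /\<^sub>R \<beta>))\<^sup>2)) =
        x * N + t * N ^ 3 + \<phi> z"
      using \<alpha> \<beta> by (simp add: z \<phi>_def power2_eq_square power3_eq_cube field_simps)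
    moreover have "fourier ?u (N + a / \<alpha>, b /\<^sub>R \<beta>) = complex_of_real (exp (- (norm z)\<^sup>2 / 2))"
      unfolding fu using \<alpha> \<beta> by (simp add: z norm_Pair)
    moreover have e: "exp (\<i> * complex_of_real p) * (exp (\<i> * complex_of_real q) * v) =
        exp (\<i> * complex_of_real (p + q)) * v" for p q v
      by (simp add: exp_add distrib_left)
    ultimately show ?thesis
      unfolding F_def z fst_conv snd_conv e by (simp only:)
  qed
  have "linear_group t ?u (x, y) =
      complex_of_real ((2 * pi) powr (- real (CARD('n) + 1) / 2)) * (LINT \<zeta>|lborel. F \<zeta>)"
    unfolding linear_group_def inverse_fourier_def F_def
    by (simp add: split_beta add.commute)
  also have "(LINT \<zeta>|lborel. F \<zeta>) = complex_of_real (1 / (\<alpha> * \<beta> ^ CARD('n))) *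
      (exp (\<i> * complex_of_real (x * N + t * N ^ 3)) *
      (LINT z|lborel. exp (\<i> * complex_of_real (\<phi> z)) * complex_of_real (exp (- (norm z)\<^sup>2 / 2))))"
    by (subst integral_lborel_anisotropic_affine[OF \<alpha> \<beta> F, of N]) (simp add: FT)
  finally show ?thesis
    using \<alpha> \<beta> by (simp add: norm_mult norm_divide norm_power)
qed

text \<open>The hypotheses say that each monomial of the phase has a coefficient of size at most
  \<open>c\<close> after rescaling. Here \<open>a\<close> and \<open>b\<close> stand for the
  x-frequency and the length of the y-frequency, \<open>Y\<close> for the inner product of y with
  the latter, and \<open>r\<close> for the length of the whole frequency. The sum c (2r + 4r^2 +
  2r^3) is then absorbed into one cube.\<close>

lemma anisotropic_phase_bound:
  fixes a r :: real
  assumes \<alpha>: "0 < \<alpha>" and \<beta>: "0 < \<beta>" and N: "0 \<le> N" and t: "0 \<le> t" and c: "0 \<le> c"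
    and X: "\<bar>X\<bar> \<le> c * \<alpha>" and Y: "\<bar>Y\<bar> \<le> c * \<beta> * b"
    and t1: "t * N \<le> c * \<alpha>\<^sup>2" and t2: "t \<le> c * \<alpha> ^ 3" and t3: "t * N \<le> c * \<beta>\<^sup>2" and t4: "t \<le> c * (\<alpha> * \<beta>\<^sup>2)"
    and a: "\<bar>a\<bar> \<le> r" and b: "0 \<le> b" "b \<le> r"
  shows "\<bar>a * X / \<alpha> + Y / \<beta> + t * (3 * N * a\<^sup>2 / \<alpha>\<^sup>2 + a ^ 3 / \<alpha> ^ 3 + N * b\<^sup>2 / \<beta>\<^sup>2 + a * b\<^sup>2 / (\<alpha> * \<beta>\<^sup>2))\<bar>
    \<le> c * (8 * (1 + r) ^ 3)"
proof -
  have r: "0 \<le> r" using b by simp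
  have q: "\<bar>u * v\<bar> \<le> c * w" if "\<bar>u\<bar> \<le> c" "\<bar>v\<bar> \<le> w" for u v w
    using mult_mono[OF that] c by (simp add: abs_mult)
  have 1: "\<bar>(X / \<alpha>) * a\<bar> \<le> c * r"
    using X \<alpha> a by (intro q) (auto simp: abs_divide field_simps)
  have "\<bar>Y / \<beta>\<bar> \<le> c * b"
    using Y \<beta> by (simp add: abs_divide field_simps)
  also have "\<dots> \<le> c * r"
    using b c by (intro mult_left_mono)
  finally have 2: "\<bar>Y / \<beta>\<bar> \<le> c * r" .
  have a2: "a\<^sup>2 \<le> r\<^sup>2" and b2: "b\<^sup>2 \<le> r\<^sup>2" and a3: "\<bar>a ^ 3\<bar> \<le> r ^ 3"
    using a b power_mono[of "\<bar>a\<bar>" r 2] power_mono[of "\<bar>a\<bar>" r 3] power_mono[of b r 2] by (simp_all add: power_abs)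
  have 3: "\<bar>(t * N / \<alpha>\<^sup>2) * (3 * a\<^sup>2)\<bar> \<le> c * (3 * r\<^sup>2)"
    using t1 \<alpha> t N a2 by (intro q) (auto simp: field_simps)
  have 4: "\<bar>(t / \<alpha> ^ 3) * a ^ 3\<bar> \<le> c * r ^ 3"
    using t2 \<alpha> t a3 by (intro q) (auto simp: field_simps)
  have 5: "\<bar>(t * N / \<beta>\<^sup>2) * b\<^sup>2\<bar> \<le> c * r\<^sup>2"
    using t3 \<beta> t N b2 by (intro q) (auto simp: field_simps)
  have "\<bar>a * b\<^sup>2\<bar> \<le> r * r\<^sup>2"
    unfolding abs_mult using a b2 r by (intro mult_mono) auto
  then have 6: "\<bar>(t / (\<alpha> * \<beta>\<^sup>2)) * (a * b\<^sup>2)\<bar> \<le> c * r ^ 3"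
    using t4 \<alpha> \<beta> t by (intro q) (auto simp: field_simps power2_eq_square power3_eq_cube)
  have "a * X / \<alpha> + Y / \<beta> + t * (3 * N * a\<^sup>2 / \<alpha>\<^sup>2 + a ^ 3 / \<alpha> ^ 3 + N * b\<^sup>2 / \<beta>\<^sup>2 + a * b\<^sup>2 / (\<alpha> * \<beta>\<^sup>2)) =
      (X / \<alpha>) * a + Y / \<beta> + (t * N / \<alpha>\<^sup>2) * (3 * a\<^sup>2) + (t / \<alpha> ^ 3) * a ^ 3 + (t * N / \<beta>\<^sup>2) * b\<^sup>2 + (t / (\<alpha> * \<beta>\<^sup>2)) * (a * b\<^sup>2)"
    by (simp add: algebra_simps)
  then have "\<bar>a * X / \<alpha> + Y / \<beta> + t * (3 * N * a\<^sup>2 / \<alpha>\<^sup>2 + a ^ 3 / \<alpha> ^ 3 + N * b\<^sup>2 / \<beta>\<^sup>2 + a * b\<^sup>2 / (\<alpha> * \<beta>\<^sup>2))\<bar> \<le>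
      c * r + c * r + c * (3 * r\<^sup>2) + c * r ^ 3 + c * r\<^sup>2 + c * r ^ 3"
    by (elim ssubst) (intro order_trans[OF abs_triangle_ineq] add_mono 1 2 3 4 5 6)
  also have "\<dots> = c * (2 * r + 4 * r\<^sup>2 + 2 * r ^ 3)"
    by (simp add: algebra_simps)
  also have "\<dots> \<le> c * (8 * (1 + r) ^ 3)"
    using c r by (intro mult_left_mono) (auto simp: power3_eq_cube power2_eq_square algebra_simps)
  finally show ?thesis .
qed

text \<open>With phase zero the oscillatory integral is the full Gaussian mass \<open>I\<close>. By
  |exp(i \<phi>) - 1| <= |\<phi>|, a phase of size at most 8c (1 + |z|)^3 changes it by at most c J,
  so half of the mass survives. The constants depend only on the dimension.\<close>

lemma linear_group_anisotropic_packet_ge: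
  "\<exists>c \<kappa>. 0 < c \<and> c \<le> 1 \<and> 0 < \<kappa> \<and> (\<forall>\<alpha> \<beta> N t x. \<forall>y :: real ^ 'n. 0 < \<alpha> \<longrightarrow> 0 < \<beta> \<longrightarrow> 0 \<le> N \<longrightarrow> 0 \<le> t \<longrightarrow>
     \<bar>x + 3 * N\<^sup>2 * t\<bar> \<le> c * \<alpha> \<longrightarrow> norm y \<le> c * \<beta> \<longrightarrow> t * N \<le> c * \<alpha>\<^sup>2 \<longrightarrow> t \<le> c * \<alpha> ^ 3 \<longrightarrow>
     t * N \<le> c * \<beta>\<^sup>2 \<longrightarrow> t \<le> c * (\<alpha> * \<beta>\<^sup>2) \<longrightarrow>
     \<kappa> / (\<alpha> * \<beta> ^ CARD('n)) \<le> norm (linear_group t (anisotropic_packet \<alpha> \<beta> N) (x, y)))"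
proof -
  define g where "g z = exp (- (norm z)\<^sup>2 / 2)" for z :: "real \<times> (real ^ 'n)"
  define I where "I = (LINT z|lborel. g z)"
  define J where "J = (LINT z|lborel. 8 * ((1 + norm z) ^ 3 * g z))"
  have g: "integrable lborel g"
    using integrable_power_mult_gaussian[of 0] by (simp add: g_def[abs_def])
  have g3: "integrable lborel (\<lambda>z. 8 * ((1 + norm z) ^ 3 * g z))"
    unfolding g_def by (intro integrable_mult_right integrable_power_mult_gaussian)
  have "I \<noteq> 0"
  proof
    assume "I = 0"
    then have "AE z in lborel. g z = 0"
      using g unfolding I_def by (subst (asm) integral_nonneg_eq_0_iff_AE) (auto simp: g_def)
    then have "AE z in (lborel :: (real \<times> (real ^ 'n)) measure). False"
      by (simp add: g_def)
    then show False
      by (simp add: AE_iff_measurable[OF _ refl])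
  qed
  moreover have "0 \<le> I"
    unfolding I_def by (intro integral_nonneg_AE AE_I2) (simp add: g_def)
  ultimately have I: "0 < I" by simp
  have J: "0 \<le> J"
    unfolding J_def by (intro integral_nonneg_AE AE_I2) (simp add: g_def)
  \<comment> \<open>Small enough for c J <= I/2; the cap at 1 later keeps the chosen times inside
    [0, 1].\<close>
  define c where "c = min 1 (I / (2 * (J + 1)))"
  have c: "0 < c" "c \<le> 1" "c * J \<le> I / 2"
  proof -
    show "0 < c" "c \<le> 1"
      using I J by (auto simp: c_def)
    have "c * J \<le> I / (2 * (J + 1)) * J"
      using J by (intro mult_right_mono) (auto simp: c_def)
    also have "\<dots> \<le> I / 2"
      using I J by (simp add: field_simps)
    finally show "c * J \<le> I / 2" .
  qed
  define \<kappa> where "\<kappa> = (2 * pi) powr (- real (CARD('n) + 1) / 2) * (I / 2)"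
  have "\<kappa> / (\<alpha> * \<beta> ^ CARD('n)) \<le> norm (linear_group t (anisotropic_packet \<alpha> \<beta> N) (x, y))"
    if \<alpha>: "0 < \<alpha>" and \<beta>: "0 < \<beta>" and N: "0 \<le> N" and t: "0 \<le> t" and x: "\<bar>x + 3 * N\<^sup>2 * t\<bar> \<le> c * \<alpha>" and y: "norm y \<le> c * \<beta>"
      and t': "t * N \<le> c * \<alpha>\<^sup>2" "t \<le> c * \<alpha> ^ 3" "t * N \<le> c * \<beta>\<^sup>2" "t \<le> c * (\<alpha> * \<beta>\<^sup>2)"
    for \<alpha> \<beta> N t x and y :: "real ^ 'n"
  proof -
    define \<phi> where "\<phi> z = fst z * (x + 3 * N\<^sup>2 * t) / \<alpha> + (y \<bullet> snd z) / \<beta> +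
      t * (3 * N * (fst z)\<^sup>2 / \<alpha>\<^sup>2 + fst z ^ 3 / \<alpha> ^ 3 + N * (norm (snd z))\<^sup>2 / \<beta>\<^sup>2 +
        fst z * (norm (snd z))\<^sup>2 / (\<alpha> * \<beta>\<^sup>2))" for z
    define S where "S = (LINT z|lborel. exp (\<i> * complex_of_real (\<phi> z)) * complex_of_real (g z))"
    have \<phi>_le: "\<bar>\<phi> z\<bar> \<le> c * (8 * (1 + norm z) ^ 3)" for z
      unfolding \<phi>_def
    proof (rule anisotropic_phase_bound[OF \<alpha> \<beta> N t _ x _ t'])
      show "\<bar>y \<bullet> snd z\<bar> \<le> c * \<beta> * norm (snd z)"
        using Cauchy_Schwarz_ineq2[of y "snd z"] mult_right_mono[OF y, of "norm (snd z)"] by simp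
      show "\<bar>fst z\<bar> \<le> norm z" "norm (snd z) \<le> norm z"
        using norm_fst_le[of "fst z" "snd z"] norm_snd_le[of "snd z" "fst z"] by auto
    qed (use c in auto)
    have \<phi>_meas [measurable]: "\<phi> \<in> borel_measurable borel"
      unfolding \<phi>_def using \<alpha> \<beta> by (intro borel_measurable_continuous_onI continuous_intros) auto
    have [measurable]: "g \<in> borel_measurable borel"
      using g by simp
    have gc: "integrable lborel (\<lambda>z. complex_of_real (g z))"
      using g by simp
    have int: "integrable lborel (\<lambda>z. exp (\<i> * complex_of_real (\<phi> z)) * complex_of_real (g z))"
      by (rule Bochner_Integration.integrable_bound[OF g]) (auto simp: norm_mult)
    have "norm (S - complex_of_real I) = norm (LINT z|lborel. (exp (\<i> * complex_of_real (\<phi> z)) - 1) * complex_of_real (g z))"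
      unfolding S_def I_def integral_complex_of_real[symmetric]
      by (subst Bochner_Integration.integral_diff[OF int gc, symmetric]) (simp add: left_diff_distrib)
    also have "\<dots> \<le> (LINT z|lborel. c * (8 * ((1 + norm z) ^ 3 * g z)))"
    proof (rule Bochner_Integration.integral_norm_bound_integral)
      show "integrable lborel (\<lambda>z. (exp (\<i> * complex_of_real (\<phi> z)) - 1) * complex_of_real (g z))"
        unfolding left_diff_distrib by (simp add: int gc)
      show "integrable lborel (\<lambda>z. c * (8 * ((1 + norm z) ^ 3 * g z)))"
        by (intro integrable_mult_right g3)
      fix z :: "real \<times> (real ^ 'n)"
      have "norm (exp (\<i> * complex_of_real (\<phi> z)) - 1) \<le> c * (8 * (1 + norm z) ^ 3)"
        using norm_iexp_diff_one_le[of "\<phi> z"] \<phi>_le[of z] by linarith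
      from mult_right_mono[OF this, of "g z"]
      show "norm ((exp (\<i> * complex_of_real (\<phi> z)) - 1) * complex_of_real (g z)) \<le> c * (8 * ((1 + norm z) ^ 3 * g z))"
        by (simp add: norm_mult g_def mult.assoc)
    qed
    also have "\<dots> = c * J"
      by (simp add: J_def)
    finally have "norm (S - complex_of_real I) \<le> I / 2"
      using c by simp
    then have "I / 2 \<le> norm S"
      using norm_triangle_ineq2[of "complex_of_real I" S] I by (simp add: norm_minus_commute)
    then have "(2 * pi) powr (- real (CARD('n) + 1) / 2) / (\<alpha> * \<beta> ^ CARD('n)) * (I / 2) \<le>
        (2 * pi) powr (- real (CARD('n) + 1) / 2) / (\<alpha> * \<beta> ^ CARD('n)) * norm S"
      using \<alpha> \<beta> by (intro mult_left_mono) auto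
    moreover have "norm (linear_group t (anisotropic_packet \<alpha> \<beta> N) (x, y)) =
        (2 * pi) powr (- real (CARD('n) + 1) / 2) / (\<alpha> * \<beta> ^ CARD('n)) * norm S"
      unfolding S_def g_def \<phi>_def by (rule linear_group_anisotropic_packet[OF \<alpha> \<beta>])
    ultimately show ?thesis
      unfolding \<kappa>_def by simp
  qed
  then show ?thesis
    using c I by (intro exI[of _ c] exI[of _ \<kappa>]) (auto simp: \<kappa>_def)
qed

section \<open>Testing the maximal estimates on packets\<close>

text \<open>A larger exponent on the left would violate the inequality for large \<open>R\<close>.
  The witness makes R^(a - b) equal to K + 1.\<close>

lemma powr_le_imp_exponent_le:
  fixes a b K :: real
  assumes le: "\<And>R. 1 \<le> R \<Longrightarrow> R powr a \<le> K * R powr b"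
  shows "a \<le> b"
proof (rule ccontr)
  assume "\<not> a \<le> b"
  then have ab: "0 < a - b" by simp
  have "1 \<le> K"
    using le[of 1] by simp
  define R where "R = (K + 1) powr (1 / (a - b))"
  have R: "1 \<le> R"
    unfolding R_def using \<open>1 \<le> K\<close> ab by (intro ge_one_powr_ge_zero) auto
  have "R powr (a - b) * R powr b \<le> K * R powr b"
    using le[OF R] by (simp flip: powr_add)
  then have "R powr (a - b) \<le> K"
    using R by simp
  moreover have "R powr (a - b) = K + 1"
    using ab \<open>1 \<le> K\<close> by (simp add: R_def powr_powr)
  ultimately show False by simp
qed

text \<open>A Chebyshev-type bound: the outer integral is restricted to \<open>S\<close>, where the
  supremum is at least \<open>A\<close>. Both the point y and the time may depend on x.\<close>

lemma norm_Lp_x_Linf_yt_ge: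
  assumes p: "0 < p" and A: "0 \<le> A" and V: "0 \<le> V" "ennreal V \<le> emeasure lborel S" and S: "S \<in> sets lborel"
    and large: "\<And>x. x \<in> S \<Longrightarrow> \<exists>y. \<exists>t\<in>{0..1}. A \<le> norm (F t (x, y))"
  shows "ennreal (V powr (1 / p) * A) \<le> norm_Lp_x_Linf_yt p F"
proof -
  have "ennreal (V * A powr p) \<le> ennreal (A powr p) * emeasure lborel S"
    unfolding mult.commute[of V] using V by (simp add: ennreal_mult' mult_left_mono)
  also have "\<dots> = (\<integral>\<^sup>+ x. ennreal (A powr p) * indicator S x \<partial>lborel)"
    using S by (simp add: nn_integral_cmult_indicator)
  also have "\<dots> \<le> (\<integral>\<^sup>+ x. (SUP (y, t) \<in> UNIV \<times> {0..1}. ennreal (norm (F t (x, y)) powr p)) \<partial>lborel)"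
  proof (intro nn_integral_mono)
    fix x
    show "ennreal (A powr p) * indicator S x \<le> (SUP (y, t) \<in> UNIV \<times> {0..1}. ennreal (norm (F t (x, y)) powr p))"
    proof (cases "x \<in> S")
      case True
      then obtain y t where "t \<in> {0..1}" "A \<le> norm (F t (x, y))"
        using large by blast
      then show ?thesis
        using True A p by (intro SUP_upper2[of "(y, t)"]) (auto intro!: ennreal_leI powr_mono2)
    qed simp
  qed
  finally have "ennreal_rpow (ennreal (V * A powr p)) (1 / p) \<le> norm_Lp_x_Linf_yt p F"
    unfolding norm_Lp_x_Linf_yt_def using p by (intro ennreal_rpow_mono) auto
  then show ?thesis
    using p A V by (simp add: ennreal_rpow_ennreal powr_mult powr_powr)
qed

lemma norm_Lp_xy_Linf_t_ge:
  assumes p: "0 < p" and A: "0 \<le> A" and V: "0 \<le> V" "ennreal V \<le> emeasure lborel S" and S: "S \<in> sets lborel"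
    and large: "\<And>z. z \<in> S \<Longrightarrow> \<exists>t\<in>{0..1}. A \<le> norm (F t z)"
  shows "ennreal (V powr (1 / p) * A) \<le> norm_Lp_xy_Linf_t p F"
proof -
  have "ennreal (V * A powr p) \<le> ennreal (A powr p) * emeasure lborel S"
    unfolding mult.commute[of V] using V by (simp add: ennreal_mult' mult_left_mono)
  also have "\<dots> = (\<integral>\<^sup>+ z. ennreal (A powr p) * indicator S z \<partial>lborel)"
    using S by (simp add: nn_integral_cmult_indicator)
  also have "\<dots> \<le> (\<integral>\<^sup>+ z. (SUP t \<in> {0..1}. ennreal (norm (F t z) powr p)) \<partial>lborel)"
  proof (intro nn_integral_mono)
    fix z
    show "ennreal (A powr p) * indicator S z \<le> (SUP t \<in> {0..1}. ennreal (norm (F t z) powr p))"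
    proof (cases "z \<in> S")
      case True
      then obtain t where "t \<in> {0..1}" "A \<le> norm (F t z)"
        using large by blast
      then show ?thesis
        using True A p by (intro SUP_upper2[of t]) (auto intro!: ennreal_leI powr_mono2)
    qed simp
  qed
  finally have "ennreal_rpow (ennreal (V * A powr p)) (1 / p) \<le> norm_Lp_xy_Linf_t p F"
    unfolding norm_Lp_xy_Linf_t_def using p by (intro ennreal_rpow_mono) auto
  then show ?thesis
    using p A V by (simp add: ennreal_rpow_ennreal powr_mult powr_powr)
qed

text \<open>Balances the two sides of a tested estimate: the solution has height \<kappa>/A on the
  test set, while the Sobolev norm of the data is only of order A^(-1/2).\<close>

lemma cancel_amplitude:
  fixes A v \<kappa> B :: real
  assumes "0 < A" "0 < \<kappa>" "v * (\<kappa> / A) \<le> B / sqrt A"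
  shows "v \<le> B / \<kappa> * sqrt A"
proof -
  have "v * (\<kappa> / A) * A \<le> B / sqrt A * A"
    using assms by (intro mult_right_mono) auto
  also have "B / sqrt A * A = B * sqrt A"
    using assms real_sqrt_mult_self[of A] by (simp add: field_simps)
  finally show ?thesis
    using assms by (simp add: field_simps)
qed

text \<open>Here the initial datum alone is enough: with N = 0, t = 0 and y = 0 the packet is large
  for x in an interval of length c \<alpha>, which produces the left side.\<close>

lemma maximal_x_estimate_packets:
  fixes p s C :: real
  assumes p: "1 < p" and s: "0 \<le> s"
    and est: "\<And>u\<^sub>0 :: real \<times> (real ^ 'n) \<Rightarrow> complex. schwartz u\<^sub>0 \<Longrightarrow>
         norm_Lp_x_Linf_yt p (\<lambda>t. linear_group t u\<^sub>0) \<le> ennreal C * sobolev_norm s u\<^sub>0"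
  shows "\<exists>K. \<forall>\<alpha> \<beta> M. 0 < \<alpha> \<longrightarrow> 0 < \<beta> \<longrightarrow> 1 \<le> M \<longrightarrow> 1 \<le> M * \<alpha> \<longrightarrow> 1 \<le> M * \<beta> \<longrightarrow>
    \<alpha> powr (1 / p) \<le> K * M powr s * sqrt (\<alpha> * \<beta> ^ CARD('n))"
proof -
  obtain c \<kappa> where c: "0 < c" "c \<le> 1" and \<kappa>: "0 < \<kappa>"
    and low: "\<And>\<alpha> \<beta> N t x. \<And>y :: real ^ 'n. 0 < \<alpha> \<Longrightarrow> 0 < \<beta> \<Longrightarrow> 0 \<le> N \<Longrightarrow> 0 \<le> t \<Longrightarrow>
     \<bar>x + 3 * N\<^sup>2 * t\<bar> \<le> c * \<alpha> \<Longrightarrow> norm y \<le> c * \<beta> \<Longrightarrow> t * N \<le> c * \<alpha>\<^sup>2 \<Longrightarrow> t \<le> c * \<alpha> ^ 3 \<Longrightarrow>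
     t * N \<le> c * \<beta>\<^sup>2 \<Longrightarrow> t \<le> c * (\<alpha> * \<beta>\<^sup>2) \<Longrightarrow>
     \<kappa> / (\<alpha> * \<beta> ^ CARD('n)) \<le> norm (linear_group t (anisotropic_packet \<alpha> \<beta> N) (x, y))"
    using linear_group_anisotropic_packet_ge[where 'n='n] by blast
  obtain K where K: "0 < K" and sob: "\<And>\<alpha> \<beta> N M. 0 < \<alpha> \<Longrightarrow> 0 < \<beta> \<Longrightarrow> 1 \<le> M \<Longrightarrow> \<bar>N\<bar> \<le> M \<Longrightarrow> 1 \<le> M * \<alpha> \<Longrightarrow> 1 \<le> M * \<beta> \<Longrightarrow>
    sobolev_norm s (anisotropic_packet \<alpha> \<beta> N :: real \<times> (real ^ 'n) \<Rightarrow> complex) \<le>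
      ennreal (K * M powr s / sqrt (\<alpha> * \<beta> ^ CARD('n)))"
    using sobolev_norm_anisotropic_packet_le[OF s, where 'n='n] by blast
  have "\<alpha> powr (1 / p) \<le> \<bar>C\<bar> * K / \<kappa> / c powr (1 / p) * M powr s * sqrt (\<alpha> * \<beta> ^ CARD('n))"
    if \<alpha>: "0 < \<alpha>" and \<beta>: "0 < \<beta>" and M: "1 \<le> M" "1 \<le> M * \<alpha>" "1 \<le> M * \<beta>" for \<alpha> \<beta> M
  proof -
    let ?A = "\<alpha> * \<beta> ^ CARD('n)"
    let ?u = "anisotropic_packet \<alpha> \<beta> 0 :: real \<times> (real ^ 'n) \<Rightarrow> complex"
    have A: "0 < ?A" using \<alpha> \<beta> by simp
    have "ennreal ((c * \<alpha>) powr (1 / p) * (\<kappa> / ?A)) \<le> norm_Lp_x_Linf_yt p (\<lambda>t. linear_group t ?u)"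
    proof (rule norm_Lp_x_Linf_yt_ge[of _ _ _ "{0..c * \<alpha>}"])
      fix x assume "x \<in> {0..c * \<alpha>}"
      then have "\<kappa> / ?A \<le> norm (linear_group 0 ?u (x, 0))"
        using \<alpha> \<beta> c by (intro low) auto
      then show "\<exists>y. \<exists>t\<in>{0..1}. \<kappa> / ?A \<le> norm (linear_group t ?u (x, y))"
        by (intro exI[of _ 0] bexI[of _ 0]) auto
    qed (use p \<kappa> A c \<alpha> in auto)
    \<comment> \<open>As \<open>ennreal\<close> sends negative numbers to 0, passing to |C| loses
      nothing and allows the return to real arithmetic.\<close>
    also have "\<dots> \<le> ennreal \<bar>C\<bar> * sobolev_norm s ?u"
      by (rule order_trans[OF est]) (auto intro!: schwartz_anisotropic_packet \<alpha> \<beta> mult_right_mono ennreal_leI)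
    also have "\<dots> \<le> ennreal \<bar>C\<bar> * ennreal (K * M powr s / sqrt ?A)"
      using \<alpha> \<beta> M by (intro mult_left_mono sob) auto
    finally have "(c * \<alpha>) powr (1 / p) * (\<kappa> / ?A) \<le> \<bar>C\<bar> * K * M powr s / sqrt ?A"
      using K A by (simp add: ennreal_mult'[symmetric])
    from cancel_amplitude[OF A \<kappa> this] show ?thesis
      using c \<alpha> \<kappa> by (simp add: powr_mult field_simps)
  qed
  then show ?thesis by blast
qed

text \<open>Two families are tested: packets centred at frequency 0 at time 0, and packets of
  frequency \<open>N\<close> and width sqrt(N), followed along their motion through a tube of length
  comparable to N^2.\<close>

lemma maximal_xy_estimate_packets:
  fixes p s C :: real
  assumes p: "1 < p" and s: "0 \<le> s"
    and est: "\<And>u\<^sub>0 :: real \<times> (real ^ 'n) \<Rightarrow> complex. schwartz u\<^sub>0 \<Longrightarrow>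
         norm_Lp_xy_Linf_t p (\<lambda>t. linear_group t u\<^sub>0) \<le> ennreal C * sobolev_norm s u\<^sub>0"
  shows "\<exists>K. (\<forall>\<alpha> \<beta> M. 0 < \<alpha> \<longrightarrow> 0 < \<beta> \<longrightarrow> 1 \<le> M \<longrightarrow> 1 \<le> M * \<alpha> \<longrightarrow> 1 \<le> M * \<beta> \<longrightarrow>
      (\<alpha> * \<beta> ^ CARD('n)) powr (1 / p) \<le> K * M powr s * sqrt (\<alpha> * \<beta> ^ CARD('n))) \<and>
    (\<forall>N\<ge>1. (N\<^sup>2 * sqrt N ^ CARD('n)) powr (1 / p) \<le> K * N powr s * sqrt (sqrt N * sqrt N ^ CARD('n)))"
proof -
  obtain c \<kappa> where c: "0 < c" "c \<le> 1" and \<kappa>: "0 < \<kappa>"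
    and low: "\<And>\<alpha> \<beta> N t x. \<And>y :: real ^ 'n. 0 < \<alpha> \<Longrightarrow> 0 < \<beta> \<Longrightarrow> 0 \<le> N \<Longrightarrow> 0 \<le> t \<Longrightarrow>
     \<bar>x + 3 * N\<^sup>2 * t\<bar> \<le> c * \<alpha> \<Longrightarrow> norm y \<le> c * \<beta> \<Longrightarrow> t * N \<le> c * \<alpha>\<^sup>2 \<Longrightarrow> t \<le> c * \<alpha> ^ 3 \<Longrightarrow>
     t * N \<le> c * \<beta>\<^sup>2 \<Longrightarrow> t \<le> c * (\<alpha> * \<beta>\<^sup>2) \<Longrightarrow>
     \<kappa> / (\<alpha> * \<beta> ^ CARD('n)) \<le> norm (linear_group t (anisotropic_packet \<alpha> \<beta> N) (x, y))"
    using linear_group_anisotropic_packet_ge[where 'n='n] by blast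
  obtain K where K: "0 < K" and sob: "\<And>\<alpha> \<beta> N M. 0 < \<alpha> \<Longrightarrow> 0 < \<beta> \<Longrightarrow> 1 \<le> M \<Longrightarrow> \<bar>N\<bar> \<le> M \<Longrightarrow> 1 \<le> M * \<alpha> \<Longrightarrow> 1 \<le> M * \<beta> \<Longrightarrow>
    sobolev_norm s (anisotropic_packet \<alpha> \<beta> N :: real \<times> (real ^ 'n) \<Rightarrow> complex) \<le>
      ennreal (K * M powr s / sqrt (\<alpha> * \<beta> ^ CARD('n)))"
    using sobolev_norm_anisotropic_packet_le[OF s, where 'n='n] by blast
  \<comment> \<open>The interval of length c L times the ball of radius c \<beta> has measure
    \<omega> L \<beta>^n.\<close>
  define \<omega> where "\<omega> = unit_ball_vol (real CARD('n)) * c ^ CARD('n) * c"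
  have \<omega>: "0 < \<omega>"
    using c by (simp add: \<omega>_def)
  define K' where "K' = \<bar>C\<bar> * K / \<kappa> / \<omega> powr (1 / p)"
  \<comment> \<open>\<open>L\<close> measures the x-range swept by the packet, and
    \<open>adm\<close> supplies for each such x a time at which the packet is there and has not yet
    dispersed. Both families are instances.\<close>
  have main: "(L * \<beta> ^ CARD('n)) powr (1 / p) \<le> K' * M powr s * sqrt (\<alpha> * \<beta> ^ CARD('n))"
    if \<alpha>: "0 < \<alpha>" and \<beta>: "0 < \<beta>" and M: "1 \<le> M" "1 \<le> M * \<alpha>" "1 \<le> M * \<beta>" and N: "0 \<le> N" "N \<le> M" and L: "0 < L"
      and adm: "\<And>x. x \<in> {- (c * L)..0} \<Longrightarrow> \<exists>t\<in>{0..1}. \<bar>x + 3 * N\<^sup>2 * t\<bar> \<le> c * \<alpha> \<and>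
        t * N \<le> c * \<alpha>\<^sup>2 \<and> t \<le> c * \<alpha> ^ 3 \<and> t * N \<le> c * \<beta>\<^sup>2 \<and> t \<le> c * (\<alpha> * \<beta>\<^sup>2)"
    for \<alpha> \<beta> M N L
  proof -
    let ?A = "\<alpha> * \<beta> ^ CARD('n)"
    let ?S = "{- (c * L)..0} \<times> cball (0 :: real ^ 'n) (c * \<beta>)"
    let ?u = "anisotropic_packet \<alpha> \<beta> N :: real \<times> (real ^ 'n) \<Rightarrow> complex"
    have A: "0 < ?A" using \<alpha> \<beta> by simp
    have "emeasure (lborel :: (real \<times> (real ^ 'n)) measure) ?S = ennreal (c * L) * ennreal (unit_ball_vol (real CARD('n)) * (c * \<beta>) ^ CARD('n))"
      unfolding lborel_prod[symmetric] using c L \<beta>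
      by (subst lborel.emeasure_pair_measure_Times) (auto simp: emeasure_cball)
    also have "\<dots> = ennreal (\<omega> * (L * \<beta> ^ CARD('n)))"
      using c L \<beta> by (subst ennreal_mult'[symmetric]) (auto simp: \<omega>_def power_mult_distrib mult_ac)
    finally have vol: "ennreal (\<omega> * (L * \<beta> ^ CARD('n))) \<le> emeasure (lborel :: (real \<times> (real ^ 'n)) measure) ?S"
      by simp
    have "ennreal ((\<omega> * (L * \<beta> ^ CARD('n))) powr (1 / p) * (\<kappa> / ?A)) \<le> norm_Lp_xy_Linf_t p (\<lambda>t. linear_group t ?u)"
    proof (rule norm_Lp_xy_Linf_t_ge[OF _ _ _ vol])
      fix z assume "z \<in> ?S"
      then obtain x y where z: "z = (x, y)" "x \<in> {- (c * L)..0}" "norm y \<le> c * \<beta>"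
        by auto
      with adm obtain t where "t \<in> {0..1}" "\<bar>x + 3 * N\<^sup>2 * t\<bar> \<le> c * \<alpha>"
        "t * N \<le> c * \<alpha>\<^sup>2" "t \<le> c * \<alpha> ^ 3" "t * N \<le> c * \<beta>\<^sup>2" "t \<le> c * (\<alpha> * \<beta>\<^sup>2)"
        by blast
      then show "\<exists>t\<in>{0..1}. \<kappa> / ?A \<le> norm (linear_group t ?u z)"
        unfolding z(1) using \<alpha> \<beta> N z(3) by (intro bexI[of _ t] low) auto
    next
      show "?S \<in> sets lborel"
        by (simp add: borel_closed closed_Times)
    qed (use p \<kappa> A \<omega> L \<beta> in auto)
    also have "\<dots> \<le> ennreal \<bar>C\<bar> * sobolev_norm s ?u"
      by (rule order_trans[OF est]) (auto intro!: schwartz_anisotropic_packet \<alpha> \<beta> mult_right_mono ennreal_leI)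
    also have "\<dots> \<le> ennreal \<bar>C\<bar> * ennreal (K * M powr s / sqrt ?A)"
      using \<alpha> \<beta> M N by (intro mult_left_mono sob) auto
    finally have "(\<omega> * (L * \<beta> ^ CARD('n))) powr (1 / p) * (\<kappa> / ?A) \<le> \<bar>C\<bar> * K * M powr s / sqrt ?A"
      using K A by (simp add: ennreal_mult'[symmetric])
    from cancel_amplitude[OF A \<kappa> this] show ?thesis
      using \<omega> \<kappa> L \<beta> unfolding K'_def by (simp add: powr_mult field_simps)
  qed
  have "(\<alpha> * \<beta> ^ CARD('n)) powr (1 / p) \<le> K' * M powr s * sqrt (\<alpha> * \<beta> ^ CARD('n))"
    if "0 < \<alpha>" "0 < \<beta>" "1 \<le> M" "1 \<le> M * \<alpha>" "1 \<le> M * \<beta>" for \<alpha> \<beta> M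
    using that c by (intro main[of \<alpha> \<beta> M 0 \<alpha>]) (auto intro!: bexI[of _ 0])
  moreover have "(N\<^sup>2 * sqrt N ^ CARD('n)) powr (1 / p) \<le> K' * N powr s * sqrt (sqrt N * sqrt N ^ CARD('n))"
    if N: "1 \<le> N" for N
  \<comment> \<open>With width sqrt(N) the dispersion conditions t N <= c \<alpha>^2 and t N <= c
    \<beta>^2 reduce to t <= c, while the distance travelled in that time is of order N^2.\<close>
  proof (rule main[of "sqrt N" "sqrt N" N N "N\<^sup>2"])
    fix x assume x: "x \<in> {- (c * N\<^sup>2)..0}"
    \<comment> \<open>The time at which the centre of the packet, moving with velocity -3 N^2,
      reaches x.\<close>
    define t where "t = - x / (3 * N\<^sup>2)"
    have t: "0 \<le> t" "t \<le> c" "x + 3 * N\<^sup>2 * t = 0"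
      using x N c by (auto simp: t_def field_simps)
    have N3: "1 \<le> sqrt N ^ 3"
      using N by simp
    have "t \<le> c * sqrt N ^ 3"
      using mult_left_mono[OF N3 less_imp_le[OF c(1)]] t by linarith
    moreover have "t * N \<le> c * (sqrt N)\<^sup>2"
      using t N by (simp add: mult_right_mono)
    ultimately show "\<exists>t\<in>{0..1}. \<bar>x + 3 * N\<^sup>2 * t\<bar> \<le> c * sqrt N \<and>
        t * N \<le> c * (sqrt N)\<^sup>2 \<and> t \<le> c * sqrt N ^ 3 \<and> t * N \<le> c * (sqrt N)\<^sup>2 \<and> t \<le> c * (sqrt N * (sqrt N)\<^sup>2)"
      using t c N by (intro bexI[of _ t]) (auto simp: power3_eq_cube power2_eq_square mult.commute)
  qed (use N in \<open>auto intro: order_trans[of 1 N]\<close>)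
  ultimately show ?thesis by blast
qed

section \<open>Comparison of exponents for the test families\<close>

theorem proposition1p1:
  fixes d :: nat and p s :: real
  assumes "d \<ge> 2" and "CARD('n::finite) = d - 1" and "1 < p"
  shows
    "((\<exists>C::real. \<forall>u\<^sub>0 :: real \<times> (real ^ 'n) \<Rightarrow> complex. schwartz u\<^sub>0 \<longrightarrow>
         norm_Lp_x_Linf_yt p (\<lambda>t. linear_group t u\<^sub>0) \<le> ennreal C * sobolev_norm s u\<^sub>0)
       \<longrightarrow> 2 \<le> p \<and> s \<ge> real d / 2 - 1 / p)
     \<and>
     ((\<exists>C::real. \<forall>u\<^sub>0 :: real \<times> (real ^ 'n) \<Rightarrow> complex. schwartz u\<^sub>0 \<longrightarrow>
         norm_Lp_xy_Linf_t p (\<lambda>t. linear_group t u\<^sub>0) \<le> ennreal C * sobolev_norm s u\<^sub>0)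
       \<longrightarrow> 2 \<le> p \<and>
           s \<ge> max (real d * (1 / 2 - 1 / p)) (3 / (2 * p) - real d / 2 * (1 / 2 - 1 / p)))"
proof (intro conjI impI)
  have p: "0 < p" "1 < p" using assms by auto
  have n: "real CARD('n) = real d - 1" "real d \<ge> 2"
    using assms by auto
  (* The packet estimates need a nonnegative exponent. Replacing s by max s 0 weakens the
     hypothesis and costs nothing, since the lower bound claimed for s is positive: in the second
     part d (1/2 - 1/p) > 0 unless p = 2, and then the other bound is 3/4. *)
  define \<sigma> where "\<sigma> = max s 0"
  have \<sigma>: "0 \<le> \<sigma>" "s \<le> \<sigma>" by (auto simp: \<sigma>_def)
  have sob: "ennreal C * sobolev_norm s u \<le> ennreal C * sobolev_norm \<sigma> u" for C and u :: "real \<times> (real ^ 'n) \<Rightarrow> complex"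
    by (intro mult_left_mono sobolev_norm_mono \<sigma>) auto
  \<comment> \<open>All widths below are powers of one parameter \<open>R\<close>, so each tested
    inequality compares two powers of \<open>R\<close>.\<close>
  have sqrt_prod: "sqrt (R powr a * (R powr b) ^ CARD('n)) = R powr ((a + b * (real d - 1)) / 2)"
    if "1 \<le> R" for R a b :: real
    using that by (simp add: powr_half_sqrt[symmetric] powr_power powr_powr powr_add[symmetric] n mult.commute)
  {
    assume "\<exists>C::real. \<forall>u\<^sub>0 :: real \<times> (real ^ 'n) \<Rightarrow> complex. schwartz u\<^sub>0 \<longrightarrow>
         norm_Lp_x_Linf_yt p (\<lambda>t. linear_group t u\<^sub>0) \<le> ennreal C * sobolev_norm s u\<^sub>0"
    then obtain C where "\<And>u\<^sub>0 :: real \<times> (real ^ 'n) \<Rightarrow> complex. schwartz u\<^sub>0 \<Longrightarrow>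
         norm_Lp_x_Linf_yt p (\<lambda>t. linear_group t u\<^sub>0) \<le> ennreal C * sobolev_norm s u\<^sub>0"
      by blast
    then have "norm_Lp_x_Linf_yt p (\<lambda>t. linear_group t u\<^sub>0) \<le> ennreal C * sobolev_norm \<sigma> u\<^sub>0"
      if "schwartz u\<^sub>0" for u\<^sub>0 :: "real \<times> (real ^ 'n) \<Rightarrow> complex"
      using that sob order_trans by blast
    from maximal_x_estimate_packets[OF p(2) \<sigma>(1) this] obtain K where
      K: "\<And>\<alpha> \<beta> M. 0 < \<alpha> \<Longrightarrow> 0 < \<beta> \<Longrightarrow> 1 \<le> M \<Longrightarrow> 1 \<le> M * \<alpha> \<Longrightarrow> 1 \<le> M * \<beta> \<Longrightarrow>
        \<alpha> powr (1 / p) \<le> K * M powr \<sigma> * sqrt (\<alpha> * \<beta> ^ CARD('n))"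
      by blast
    \<comment> \<open>Wide packets with \<alpha> = R, \<beta> = 1, M = 1: their frequencies stay
      bounded, so the Sobolev weight contributes no power of \<open>R\<close>.\<close>
    have "1 / p \<le> 1 / 2"
    proof (rule powr_le_imp_exponent_le)
      fix R :: real assume "1 \<le> R"
      then show "R powr (1 / p) \<le> K * R powr (1 / 2)"
        using K[of R 1 1] by (simp add: powr_half_sqrt)
    qed
    then show "2 \<le> p"
      using p by (simp add: field_simps)
    \<comment> \<open>Concentrating packets with \<alpha> = \<beta> = 1/R have frequencies of size
      R, hence M = R.\<close>
    have "- 1 * (1 / p) \<le> \<sigma> + (- 1 + - 1 * (real d - 1)) / 2"
    proof (rule powr_le_imp_exponent_le)
      fix R :: real assume R: "1 \<le> R"
      have "(R powr - 1) powr (1 / p) \<le> K * R powr \<sigma> * sqrt (R powr - 1 * (R powr - 1) ^ CARD('n))"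
        using R by (intro K) (auto simp: powr_minus)
      then show "R powr (- 1 * (1 / p)) \<le> K * R powr (\<sigma> + (- 1 + - 1 * (real d - 1)) / 2)"
        by (simp only: sqrt_prod[OF R] powr_powr powr_add mult.assoc)
    qed
    then have "real d / 2 - 1 / p \<le> \<sigma>"
      by (simp add: field_simps)
    \<comment> \<open>Since 1/p < 1 <= d/2, the lower bound for \<sigma> is positive, which excludes
      \<sigma> = 0 and gives \<sigma> = s.\<close>
    moreover have "1 / p < real d / 2"
      using p n(2) divide_less_eq_1_pos[of p 1] by linarith
    ultimately show "s \<ge> real d / 2 - 1 / p"
      by (auto simp: \<sigma>_def)
  }
  {
    assume "\<exists>C::real. \<forall>u\<^sub>0 :: real \<times> (real ^ 'n) \<Rightarrow> complex. schwartz u\<^sub>0 \<longrightarrow>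
         norm_Lp_xy_Linf_t p (\<lambda>t. linear_group t u\<^sub>0) \<le> ennreal C * sobolev_norm s u\<^sub>0"
    then obtain C where "\<And>u\<^sub>0 :: real \<times> (real ^ 'n) \<Rightarrow> complex. schwartz u\<^sub>0 \<Longrightarrow>
         norm_Lp_xy_Linf_t p (\<lambda>t. linear_group t u\<^sub>0) \<le> ennreal C * sobolev_norm s u\<^sub>0"
      by blast
    then have "norm_Lp_xy_Linf_t p (\<lambda>t. linear_group t u\<^sub>0) \<le> ennreal C * sobolev_norm \<sigma> u\<^sub>0"
      if "schwartz u\<^sub>0" for u\<^sub>0 :: "real \<times> (real ^ 'n) \<Rightarrow> complex"
      using that sob order_trans by blast
    from maximal_xy_estimate_packets[OF p(2) \<sigma>(1) this] obtain K where
      K: "\<And>\<alpha> \<beta> M. 0 < \<alpha> \<Longrightarrow> 0 < \<beta> \<Longrightarrow> 1 \<le> M \<Longrightarrow> 1 \<le> M * \<alpha> \<Longrightarrow> 1 \<le> M * \<beta> \<Longrightarrow>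
        (\<alpha> * \<beta> ^ CARD('n)) powr (1 / p) \<le> K * M powr \<sigma> * sqrt (\<alpha> * \<beta> ^ CARD('n))"
      and tube: "\<And>N. 1 \<le> N \<Longrightarrow>
        (N\<^sup>2 * sqrt N ^ CARD('n)) powr (1 / p) \<le> K * N powr \<sigma> * sqrt (sqrt N * sqrt N ^ CARD('n))"
      by blast
    have "1 / p \<le> 1 / 2"
    proof (rule powr_le_imp_exponent_le)
      fix R :: real assume "1 \<le> R"
      then show "R powr (1 / p) \<le> K * R powr (1 / 2)"
        using K[of R 1 1] by (simp add: powr_half_sqrt)
    qed
    then show p2: "2 \<le> p"
      using p by (simp add: field_simps)
    have prod: "(R powr a * (R powr b) ^ CARD('n)) powr (1 / p) = R powr ((a + b * (real d - 1)) / p)"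
      if "1 \<le> R" for R a b :: real
      using that by (simp add: powr_power powr_powr powr_add[symmetric] n mult.commute)
    \<comment> \<open>Again \<alpha> = \<beta> = 1/R and M = R, but now all d coordinates contribute
      to the measure of the test set.\<close>
    have "(- 1 + - 1 * (real d - 1)) / p \<le> \<sigma> + (- 1 + - 1 * (real d - 1)) / 2"
    proof (rule powr_le_imp_exponent_le)
      fix R :: real assume R: "1 \<le> R"
      have "(R powr - 1 * (R powr - 1) ^ CARD('n)) powr (1 / p) \<le>
          K * R powr \<sigma> * sqrt (R powr - 1 * (R powr - 1) ^ CARD('n))"
        using R by (intro K) (auto simp: powr_minus)
      then show "R powr ((- 1 + - 1 * (real d - 1)) / p) \<le> K * R powr (\<sigma> + (- 1 + - 1 * (real d - 1)) / 2)"
        by (simp only: sqrt_prod[OF R] prod[OF R] powr_add mult.assoc)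
    qed
    then have first: "real d * (1 / 2 - 1 / p) \<le> \<sigma>"
      by (simp add: field_simps)
    \<comment> \<open>The tube with N = R: length R^2 and d - 1 transverse widths R^(1/2) on the
      left, d widths R^(1/2) under the square root on the right.\<close>
    have "(2 + 1 / 2 * (real d - 1)) / p \<le> \<sigma> + (1 / 2 + 1 / 2 * (real d - 1)) / 2"
    proof (rule powr_le_imp_exponent_le)
      fix R :: real assume R: "1 \<le> R"
      then have *: "R\<^sup>2 = R powr 2" "sqrt R = R powr (1 / 2)"
        by (simp_all add: powr_half_sqrt)
      show "R powr ((2 + 1 / 2 * (real d - 1)) / p) \<le> K * R powr (\<sigma> + (1 / 2 + 1 / 2 * (real d - 1)) / 2)"
        using tube[OF R] unfolding *(1) unfolding sqrt_prod[OF R, of "1/2" "1/2", folded *(2)]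
        unfolding *(2) prod[OF R] by (simp add: powr_add)
    qed
    then have second: "3 / (2 * p) - real d / 2 * (1 / 2 - 1 / p) \<le> \<sigma>"
      using p by (simp add: field_simps)
    have "0 < \<sigma>"
    proof (cases "p = 2")
      case True
      with second show ?thesis by simp
    next
      case False
      with p2 n(2) have "0 < real d * (1 / 2 - 1 / p)"
        by (intro mult_pos_pos) (auto simp: field_simps)
      with first show ?thesis by simp
    qed
    then have "s = \<sigma>"
      by (auto simp: \<sigma>_def max_def split: if_splits)
    with first second show "s \<ge> max (real d * (1 / 2 - 1 / p)) (3 / (2 * p) - real d / 2 * (1 / 2 - 1 / p))"
      by simp
  }
qed

end
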